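(* Let $k=2$ or $3$, let $[\,\cdot\,,\,\cdot\,]:\mathbf{R}^{m}\times\mathbf{R}^{m}\rightarrow\mathbf{R}^{k}$ be a non-zero bilinear map, and let $\varphi:[0,\infty)\times[0,\infty)\rightarrow[0,\infty)$ be a non-trivial (not identically zero) compactly supported $\mathcal{C}^{\infty}$ function. For $s>0$ set $\varphi_s(t_1,t_2)=\varphi(t_1,s^2t_2)$ and let $g^s=g^{[\,\cdot\,,\,\cdot\,],\varphi_s}$ be the associated Riemannian metric on $\mathbf{R}^{m+2k}$. Then, except for possibly finitely many values of $s\in(0,\infty)$, $a_{2}(g^{s})\neq0$.
   Context: Construction of the metric $g^{[\,\cdot\,,\,\cdot\,],\varphi}$ on $\mathbf{R}^{m+2k}$: let $T$ be the $k$-torus $(2\pi\mathbf{Z})^k\backslash\mathbf{R}^k$ embedded in $\mathrm{SO}(2k)$ as $\mathrm{SO}(2)\times\dots\times\mathrm{SO}(2)$, acting on $\mathbf{R}^{2k}=\mathbf{R}^2\times\dots\times\mathbf{R}^2$ by the standard $\mathrm{SO}(2)$-action in each factor; its Lie algebra is identified with $\mathbf{R}^k$. For $Z\in\mathbf{R}^k$ let $Z^*$ be the vector field on $\mathbf{R}^{2k}$ given by $Z^*_u=\frac{d}{dt}\big|_{t=0}(\exp(tZ)\cdot u)$. Given a bilinear map $[\,\cdot\,,\,\cdot\,]:\mathbf{R}^m\times\mathbf{R}^m\to\mathbf{R}^k$ and a smooth compactly supported $\varphi:[0,\infty)\times[0,\infty)\to[0,\infty)$, write points of $\mathbf{R}^{m+2k}$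 as $(x,u)$ with $x\in\mathbf{R}^m$, $u\in\mathbf{R}^{2k}$, write tangent vectors as $(Y,W)$ with $Y\in\mathbf{R}^m$, $W\in\mathbf{R}^{2k}$, and put $\psi(x,u)=\varphi(\|x\|^2,\|u\|^2)$. For $Y\in\mathbf{R}^m$ let $\tilde Y_{x,u}=(Y,\psi(x,u)[x,Y]^*_u)$. The metric $g=g^{[\,\cdot\,,\,\cdot\,],\varphi}$ is defined at $(x,u)$ by: $g((0,W),(0,V))=\langle W,V\rangle$ (Euclidean inner product on $\mathbf{R}^{2k}$); the $g$-orthogonal complement of $\{0\}\oplus\mathbf{R}^{2k}$ is $\{\tilde Y_{x,u}:Y\in\mathbf{R}^m\}$; and $Y\mapsto\tilde Y_{x,u}$ is an isometry from Euclidean $\mathbf{R}^m$ onto this complement. The metric is Euclidean outside the support of $\psi$. Second heat invariant: for a Riemannian metric $g$ on an $n$-dimensional manifold $M$, $$a_{2}(g)=\frac{(4\pi)^{-n/2}}{360}\int_{M}\left(5\tau^{2}-2\|\operatorname{Ric}\|^{2}+2\|R\|^{2}\right)\,\operatorname{dvol}_{g},$$ where $\tau$ is the scalar curvature, $\operatorname{Ric}$ the Ricci tensor and $R$ the Riemann curvature tensor. Here $M=\mathbf{R}^{m+2k}$, $n=m+2k$. *)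

theory Defs
  imports "HOL-Analysis.Analysis" "HOL-Combinatorics.Permutations"
begin

section \<open>Smooth functions\<close>

fun Ck :: "nat \<Rightarrow> ('a::euclidean_space \<Rightarrow> 'b::real_normed_vector) \<Rightarrow> bool" where
  "Ck 0 f \<longleftrightarrow> continuous_on UNIV f"
| "Ck (Suc n) f \<longleftrightarrow>
     (\<forall>x. f differentiable (at x)) \<and> (\<forall>v. Ck n (\<lambda>x. frechet_derivative f (at x) v))"

definition smooth :: "('a::euclidean_space \<Rightarrow> 'b::real_normed_vector) \<Rightarrow> bool" where
  "smooth f \<longleftrightarrow> (\<forall>n. Ck n f)"

text \<open>Functions on the closed quadrant are represented by total functions of two real
  arguments whose values outside the quadrant are irrelevant.  Smoothness up to the boundary
  means that the function is the restriction of a smooth function on the plane.\<close>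

definition quadrant :: "(real \<times> real) set" where
  "quadrant = {0..} \<times> {0..}"

definition smooth_on_quadrant :: "(real \<Rightarrow> real \<Rightarrow> real) \<Rightarrow> bool" where
  "smooth_on_quadrant \<phi> \<longleftrightarrow>
     (\<exists>\<Phi> :: real \<times> real \<Rightarrow> real. smooth \<Phi> \<and> (\<forall>(t1, t2) \<in> quadrant. \<Phi> (t1, t2) = \<phi> t1 t2))"

definition compact_support_on_quadrant :: "(real \<Rightarrow> real \<Rightarrow> real) \<Rightarrow> bool" where
  "compact_support_on_quadrant \<phi> \<longleftrightarrow> compact (closure {(t1, t2) \<in> quadrant. \<phi> t1 t2 \<noteq> 0})"


section \<open>Riemannian geometry on a Euclidean space\<close>

text \<open>A metric on the manifold \<open>'a\<close> is a function \<open>g\<close>, where \<open>g p\<close> is the inner product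
  on the tangent space at \<open>p\<close>; this tangent space is identified with \<open>'a\<close>.  The elements of
  \<open>Basis\<close> serve as the coordinate vector fields.\<close>

definition inner_product :: "('a::euclidean_space \<Rightarrow> 'a \<Rightarrow> real) \<Rightarrow> bool" where
  "inner_product h \<longleftrightarrow>
     bilinear h \<and> (\<forall>v w. h v w = h w v) \<and> (\<forall>v. v \<noteq> 0 \<longrightarrow> h v v > 0)"

type_synonym 'a metric = "'a \<Rightarrow> 'a \<Rightarrow> 'a \<Rightarrow> real"
type_synonym 'a vfield = "'a \<Rightarrow> 'a"

text \<open>The vector which \<open>g p\<close> associates to a covector.\<close>

definition sharp :: "'a::euclidean_space metric \<Rightarrow> 'a \<Rightarrow> ('a \<Rightarrow> real) \<Rightarrow> 'a" where
  "sharp g p \<alpha> = (THE v. \<forall>w. g p v w = \<alpha> w)"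

text \<open>The entry \<open>g\<^sup>i\<^sup>j\<close> of the inverse of the matrix of \<open>g p\<close>.\<close>

definition inverse_metric :: "'a::euclidean_space metric \<Rightarrow> 'a \<Rightarrow> 'a \<Rightarrow> 'a \<Rightarrow> real" where
  "inverse_metric g p i j = sharp g p (\<lambda>w. w \<bullet> j) \<bullet> i"

text \<open>The Levi-Civita derivative of the constant vector field \<open>Y\<close> in direction \<open>X\<close>, given by
  the Koszul formula, in which the Lie brackets of constant fields vanish.\<close>

definition christoffel :: "'a::euclidean_space metric \<Rightarrow> 'a \<Rightarrow> 'a \<Rightarrow> 'a \<Rightarrow> 'a" where
  "christoffel g p X Y = sharp g p (\<lambda>Z.
     (frechet_derivative (\<lambda>q. g q Y Z) (at p) X
      + frechet_derivative (\<lambda>q. g q X Z) (at p) Y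
      - frechet_derivative (\<lambda>q. g q X Y) (at p) Z) / 2)"

definition nabla :: "'a::euclidean_space metric \<Rightarrow> 'a vfield \<Rightarrow> 'a vfield \<Rightarrow> 'a vfield" where
  "nabla g X Y = (\<lambda>p. frechet_derivative Y (at p) (X p) + christoffel g p (X p) (Y p))"

definition lie_bracket :: "'a::euclidean_space vfield \<Rightarrow> 'a vfield \<Rightarrow> 'a vfield" where
  "lie_bracket X Y = (\<lambda>p. frechet_derivative Y (at p) (X p) - frechet_derivative X (at p) (Y p))"

definition curvature ::
    "'a::euclidean_space metric \<Rightarrow> 'a vfield \<Rightarrow> 'a vfield \<Rightarrow> 'a vfield \<Rightarrow> 'a vfield" where
  "curvature g X Y Z = (\<lambda>p.
     nabla g X (nabla g Y Z) p - nabla g Y (nabla g X Z) p - nabla g (lie_bracket X Y) Z p)"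

text \<open>By tensoriality the value at \<open>p\<close> may be computed on the constant extensions of the
  tangent vectors.\<close>

definition riemann :: "'a::euclidean_space metric \<Rightarrow> 'a \<Rightarrow> 'a \<Rightarrow> 'a \<Rightarrow> 'a \<Rightarrow> 'a \<Rightarrow> real" where
  "riemann g p X Y Z W = g p (curvature g (\<lambda>_. X) (\<lambda>_. Y) (\<lambda>_. Z) p) W"

text \<open>\<open>Ric(Y, Z)\<close> is the trace of the endomorphism \<open>X \<mapsto> R(X, Y) Z\<close>; a trace may be computed
  in any basis, whether or not it is orthonormal for \<open>g\<close>.\<close>

definition ricci :: "'a::euclidean_space metric \<Rightarrow> 'a \<Rightarrow> 'a \<Rightarrow> 'a \<Rightarrow> real" where
  "ricci g p Y Z = (\<Sum>b\<in>Basis. curvature g (\<lambda>_. b) (\<lambda>_. Y) (\<lambda>_. Z) p \<bullet> b)"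

definition scalar_curvature :: "'a::euclidean_space metric \<Rightarrow> 'a \<Rightarrow> real" where
  "scalar_curvature g p = (\<Sum>i\<in>Basis. \<Sum>j\<in>Basis. inverse_metric g p i j * ricci g p i j)"

definition ricci_norm_sq :: "'a::euclidean_space metric \<Rightarrow> 'a \<Rightarrow> real" where
  "ricci_norm_sq g p =
     (\<Sum>i\<in>Basis. \<Sum>j\<in>Basis. \<Sum>i'\<in>Basis. \<Sum>j'\<in>Basis.
        inverse_metric g p i i' * inverse_metric g p j j' * ricci g p i j * ricci g p i' j')"

definition riemann_norm_sq :: "'a::euclidean_space metric \<Rightarrow> 'a \<Rightarrow> real" where
  "riemann_norm_sq g p =
     (\<Sum>i\<in>Basis. \<Sum>j\<in>Basis. \<Sum>k\<in>Basis. \<Sum>l\<in>Basis.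
      \<Sum>i'\<in>Basis. \<Sum>j'\<in>Basis. \<Sum>k'\<in>Basis. \<Sum>l'\<in>Basis.
        inverse_metric g p i i' * inverse_metric g p j j'
        * inverse_metric g p k k' * inverse_metric g p l l'
        * riemann g p i j k l * riemann g p i' j' k' l')"

text \<open>The determinant of the matrix of \<open>g p\<close>, by the Leibniz formula, as the constant \<open>det\<close>
  of the library is restricted to matrices indexed by a type.\<close>

definition metric_det :: "'a::euclidean_space metric \<Rightarrow> 'a \<Rightarrow> real" where
  "metric_det g p = (\<Sum>\<pi> | \<pi> permutes Basis. of_int (sign \<pi>) * (\<Prod>i\<in>Basis. g p i (\<pi> i)))"

definition a2 :: "'a::euclidean_space metric \<Rightarrow> real" where
  "a2 g = (4 * pi) powr (- real DIM('a) / 2) / 360 *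
     (\<integral>p. (5 * (scalar_curvature g p)\<^sup>2 - 2 * ricci_norm_sq g p + 2 * riemann_norm_sq g p)
           * sqrt (metric_det g p) \<partial>lborel)"


section \<open>The metrics associated with a bilinear map\<close>

definition rotation :: "real \<Rightarrow> real^2^2" where
  "rotation t = vector [vector [cos t, - sin t], vector [sin t, cos t]]"

text \<open>The action of \<open>exp Z\<close>, where \<open>Z\<close> lies in the Lie algebra of the torus, on a product of
  \<open>k\<close> planes.\<close>

definition torus_action :: "real^'k \<Rightarrow> (real^2)^'k \<Rightarrow> (real^2)^'k" where
  "torus_action Z u = (\<chi> j. rotation (Z $ j) *v (u $ j))"

definition fundamental_field :: "real^'k \<Rightarrow> (real^2)^'k \<Rightarrow> (real^2)^'k" where
  "fundamental_field Z u = vector_derivative (\<lambda>t. torus_action (t *\<^sub>R Z) u) (at 0)"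

text \<open>Points and tangent vectors of \<open>(m+2k)\<close>-dimensional space are pairs \<open>(x, u)\<close>.\<close>

type_synonym ('m, 'k) total = "(real^'m) \<times> ((real^2)^'k)"

definition psi :: "(real \<Rightarrow> real \<Rightarrow> real) \<Rightarrow> ('m::finite, 'k::finite) total \<Rightarrow> real" where
  "psi \<phi> p = \<phi> ((norm (fst p))\<^sup>2) ((norm (snd p))\<^sup>2)"

definition horizontal_lift ::
    "(real^'m \<Rightarrow> real^'m \<Rightarrow> real^'k) \<Rightarrow> (real \<Rightarrow> real \<Rightarrow> real)
      \<Rightarrow> ('m::finite, 'k::finite) total \<Rightarrow> real^'m \<Rightarrow> ('m, 'k) total" where
  "horizontal_lift B \<phi> p Y = (Y, psi \<phi> p *\<^sub>R fundamental_field (B (fst p) Y) (snd p))"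

definition is_associated_inner ::
    "(real^'m \<Rightarrow> real^'m \<Rightarrow> real^'k) \<Rightarrow> (real \<Rightarrow> real \<Rightarrow> real)
      \<Rightarrow> ('m::finite, 'k::finite) total
      \<Rightarrow> (('m, 'k) total \<Rightarrow> ('m, 'k) total \<Rightarrow> real) \<Rightarrow> bool" where
  "is_associated_inner B \<phi> p h \<longleftrightarrow>
     inner_product h \<and>
     (\<forall>W V. h (0, W) (0, V) = W \<bullet> V) \<and>
     {v. \<forall>W. h v (0, W) = 0} = range (horizontal_lift B \<phi> p) \<and>
     (\<forall>Y Y'. h (horizontal_lift B \<phi> p Y) (horizontal_lift B \<phi> p Y') = Y \<bullet> Y')"

definition associated_metric ::
    "(real^'m \<Rightarrow> real^'m \<Rightarrow> real^'k) \<Rightarrow> (real \<Rightarrow> real \<Rightarrow> real)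
      \<Rightarrow> ('m::finite, 'k::finite) total metric" where
  "associated_metric B \<phi> p = (THE h. is_associated_inner B \<phi> p h)"


subsection \<open>The associated metric is well defined\<close>

lemma rotation_apply:
  "rotation t *v w = vector [cos t * w $ 1 - sin t * w $ 2, sin t * w $ 1 + cos t * w $ 2]"
  by (simp add: rotation_def vec_eq_iff matrix_vector_mult_def forall_2 sum_2)

lemma fundamental_field_eq:
  fixes Z :: "real^'k" and u :: "(real^2)^'k"
  shows "fundamental_field Z u = (\<chi> j. Z $ j *\<^sub>R vector [- (u $ j $ 2), u $ j $ 1])"
proof -
  have "((\<lambda>t. torus_action (t *\<^sub>R Z) u) has_vector_derivative
          (\<chi> j. Z $ j *\<^sub>R vector [- (u $ j $ 2), u $ j $ 1])) (at 0)"
    unfolding has_vector_derivative_def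
  proof (subst has_derivative_componentwise_within, safe)
    fix b :: "(real^2)^'k" assume "b \<in> Basis"
    then obtain j i where b: "b = axis j (axis i 1)"
      by (auto simp: Basis_vec_def)
    have i: "i = 1 \<or> i = 2" by (rule exhaust_2)
    show "((\<lambda>t. torus_action (t *\<^sub>R Z) u \<bullet> b) has_derivative
        (\<lambda>t. (t *\<^sub>R (\<chi> j. Z $ j *\<^sub>R vector [- (u $ j $ 2), u $ j $ 1])) \<bullet> b)) (at 0)"
      using i unfolding b torus_action_def rotation_apply
      by (auto simp: inner_axis intro!: derivative_eq_intros)
  qed
  then show ?thesis
    unfolding fundamental_field_def by (rule vector_derivative_at)
qed

lemma linear_fundamental_field: "linear (\<lambda>Z. fundamental_field Z u)"
  by (rule linearI) (simp_all add: fundamental_field_eq vec_eq_iff algebra_simps)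

lemma is_associated_inner_unique_ex:
  fixes B :: "real^'m \<Rightarrow> real^'m \<Rightarrow> real^'k"
  assumes "bilinear B"
  shows "\<exists>!h. is_associated_inner B \<phi> p h"
proof -
  define L where "L = (\<lambda>Y. psi \<phi> p *\<^sub>R fundamental_field (B (fst p) Y) (snd p))"
  have lift: "horizontal_lift B \<phi> p Y = (Y, L Y)" for Y
    by (simp add: horizontal_lift_def L_def)
  have "linear (\<lambda>Y. fundamental_field (B (fst p) Y) (snd p))"
    using linear_compose[OF _ linear_fundamental_field, of "B (fst p)" "snd p"] assms
    by (simp add: bilinear_def o_def)
  then have L: "linear L"
    unfolding L_def by (rule linear_compose_scale_right)
  define H where "H = (\<lambda>v w :: ('m, 'k) total.
    fst v \<bullet> fst w + (snd v - L (fst v)) \<bullet> (snd w - L (fst w)))"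
  have H: "is_associated_inner B \<phi> p H"
    unfolding is_associated_inner_def
  proof (intro conjI)
    have "bilinear H"
      unfolding H_def bilinear_def
      by (auto intro!: linearI simp: linear_add[OF L] linear_cmul[OF L] algebra_simps inner_simps)
    moreover have "H v v > 0" if "v \<noteq> 0" for v
    proof (cases "fst v = 0")
      case True
      with that have "snd v \<noteq> 0" by (cases v) (auto simp: zero_prod_def)
      then show ?thesis using True by (simp add: H_def linear_0[OF L])
    next
      case False
      then show ?thesis by (simp add: H_def add_pos_nonneg)
    qed
    ultimately show "inner_product H"
      unfolding inner_product_def by (auto simp: H_def inner_commute)
    show "\<forall>W V. H (0, W) (0, V) = W \<bullet> V"
      by (simp add: H_def linear_0[OF L])
    have "(\<forall>W. H v (0, W) = 0) \<longleftrightarrow> snd v = L (fst v)" for v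
      by (simp add: H_def linear_0[OF L])
    then show "{v. \<forall>W. H v (0, W) = 0} = range (horizontal_lift B \<phi> p)"
      by (auto simp: lift image_iff)
    show "\<forall>Y Y'. H (horizontal_lift B \<phi> p Y) (horizontal_lift B \<phi> p Y') = Y \<bullet> Y'"
      by (simp add: H_def lift)
  qed
  moreover have "h = H" if h: "is_associated_inner B \<phi> p h" for h
  proof (intro ext)
    fix v w :: "('m, 'k) total"
    have bil: "bilinear h" and sym: "\<And>v w. h v w = h w v"
      and vert: "\<And>W V. h (0, W) (0, V) = W \<bullet> V"
      and orth_set: "{v. \<forall>W. h v (0, W) = 0} = range (horizontal_lift B \<phi> p)"
      and iso: "\<And>Y Y'. h (Y, L Y) (Y', L Y') = Y \<bullet> Y'"
      using h unfolding is_associated_inner_def inner_product_def lift by blast+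
    have orth: "h (Y, L Y) (0, W) = 0" for Y W
    proof -
      have "horizontal_lift B \<phi> p Y \<in> {v. \<forall>W. h v (0, W) = 0}"
        unfolding orth_set by blast
      then show ?thesis by (simp add: lift)
    qed
    have orth': "h (0, W) (Y, L Y) = 0" for Y W
      using orth sym by metis
    have split: "v = (fst v, L (fst v)) + (0, snd v - L (fst v))" for v :: "('m, 'k) total"
      by (simp add: prod_eq_iff)
    have "h v w = h ((fst v, L (fst v)) + (0, snd v - L (fst v)))
                    ((fst w, L (fst w)) + (0, snd w - L (fst w)))"
      by (rule arg_cong2[OF split split])
    also have "\<dots> = H v w"
      by (simp only: bilinear_ladd[OF bil] bilinear_radd[OF bil] vert iso orth orth')
        (simp add: H_def)
    finally show "h v w = H v w" .
  qed
  ultimately show ?thesis by blast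
qed

lemma is_associated_inner_associated_metric:
  assumes "bilinear B"
  shows "is_associated_inner B \<phi> p (associated_metric B \<phi> p)"
  unfolding associated_metric_def by (rule theI'[OF is_associated_inner_unique_ex[OF assms]])

end

theory Submission
  imports Defs
begin

text \<open>In the standard coordinates the metric is \<open>|Y|\<^sup>2 + |W - A Y|\<^sup>2\<close> with the connection form
  \<open>A Y = \<psi> [x, Y]\<^sup>*\<close>, and its volume form is Euclidean (\<open>metric_det_shear\<close>).  The substitution
  \<open>v = s u\<close> turns the passage from \<open>\<phi>\<close> to \<open>\<phi>\<^sub>s\<close> into shrinking the fibres of a fixed
  connection by the factor \<open>1 / s\<close>.  In an adapted orthonormal frame a derivative along the fibre
  carries a factor \<open>s\<close>, while \<open>A\<close> itself carries \<open>1 / s\<close>; hence the components of the curvature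
  tensor are \<open>s\<close> times polynomials in \<open>1 / s\<close> (\<open>a2_density_scaled\<close>).  Since \<open>A\<close> has compact
  support, the heat invariant is a nonvanishing factor times a polynomial in \<open>1 / s\<close>, and it has
  finitely many zeros as soon as the constant term of that polynomial is not zero
  (\<open>finite_zeros_a2\<close>).

  The constant term only sees the curvature components of leading order.  These have one horizontal
  argument \<open>b\<close> and three vertical ones, and they are the numbers
  \<open>C\<^sub>b(\<alpha>, \<beta>, \<gamma>) = (\<partial>\<^sub>\<gamma>\<partial>\<^sub>\<alpha>A\<^sub>b\<^sup>\<beta> - \<partial>\<^sub>\<gamma>\<partial>\<^sub>\<beta>A\<^sub>b\<^sup>\<alpha>) / 2\<close>, up to sign and order of the arguments.  The scalar
  curvature does not contribute, and the constant term is the integral of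
  \<open>4 \<Sum>\<^sub>b (2 |C\<^sub>b|\<^sup>2 - |tr C\<^sub>b|\<^sup>2)\<close> (\<open>collapsing_density_0\<close>).  This integrand need not be nonnegative.
  However, \<open>A\<^sub>b = \<psi> J\<^sub>b u\<close> with \<open>J\<^sub>b\<close> skew and \<open>\<psi>\<close> radial along the fibre, and an explicit
  computation shows that \<open>2 |C\<^sub>b|\<^sup>2 - |tr C\<^sub>b|\<^sup>2\<close> equals \<open>12 (\<partial>\<^sub>2\<^sup>2\<phi>)\<^sup>2 |u|\<^sup>4 |J\<^sub>b u|\<^sup>2\<close> plus the
  divergence of a compactly supported vertical field (\<open>codazzi_energy_rotation\<close>,
  \<open>vertical_codazzi_energy\<close>).  The divergence integrates to zero, so the constant term is
  nonnegative, and it is positive: a compactly supported function of \<open>t\<^sub>2\<close> whose second derivative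
  vanishes is zero, and \<open>[x, b]\<close> is not zero for a suitable \<open>x\<close> of any prescribed length.\<close>

section \<open>Metrics given by a coframe\<close>

text \<open>A metric given by a linear isomorphism \<open>S p\<close> onto the model inner product space.  The vectors
  \<open>T p c\<close>, for \<open>c\<close> in \<open>Basis\<close>, are then an orthonormal frame, and every contraction of
  coordinate components with the inverse metric is a plain sum over this frame.\<close>

locale coframe_metric =
  fixes S T :: "'a::euclidean_space \<Rightarrow> 'a \<Rightarrow> 'a" and g :: "'a metric"
  assumes linear_S: "linear (S p)" and linear_T: "linear (T p)"
    and ST [simp]: "S p (T p v) = v" and TS [simp]: "T p (S p v) = v"
    and g_eq: "g p v w = S p v \<bullet> S p w"
begin

lemma g_sym: "g p v w = g p w v"
  by (simp add: g_eq inner_commute)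

lemma bilinear_g: "bilinear (g p)"
  unfolding bilinear_def g_eq
  by (auto intro!: linearI simp: linear_add[OF linear_S] linear_cmul[OF linear_S] inner_simps)

lemma g_frame: "g p v (T p c) = S p v \<bullet> c"
  by (simp add: g_eq)

lemma frame_expansion: "v = (\<Sum>c\<in>Basis. g p v (T p c) *\<^sub>R T p c)"
proof -
  have "v = T p (\<Sum>c\<in>Basis. (S p v \<bullet> c) *\<^sub>R c)"
    by (simp add: euclidean_representation)
  then show ?thesis
    by (simp add: linear_sum[OF linear_T] linear_cmul[OF linear_T] g_frame)
qed

lemma linear_frame_expansion:
  assumes "linear (\<alpha> :: 'a \<Rightarrow> real)"
  shows "\<alpha> v = (\<Sum>c\<in>Basis. g p v (T p c) * \<alpha> (T p c))"
  by (subst frame_expansion[of v p]) (simp add: linear_sum[OF assms] linear_cmul[OF assms])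

lemma g_nondegenerate:
  assumes "\<And>w. g p v w = g p v' w"
  shows "v = v'"
  by (subst frame_expansion[of v p], subst frame_expansion[of v' p]) (simp add: assms)

lemma
  assumes "linear \<alpha>"
  shows g_sharp: "g p (sharp g p \<alpha>) w = \<alpha> w"
    and sharp_eq: "sharp g p \<alpha> = (\<Sum>c\<in>Basis. \<alpha> (T p c) *\<^sub>R T p c)"
proof -
  let ?v = "\<Sum>c\<in>Basis. \<alpha> (T p c) *\<^sub>R T p c"
  have *: "g p ?v w = \<alpha> w" for w
  proof -
    have "g p ?v w = (\<Sum>c\<in>Basis. \<alpha> (T p c) * g p (T p c) w)"
    proof -
      have lin: "linear (\<lambda>v. g p v w)"
        using bilinear_g[of p] by (simp add: bilinear_def)
      show ?thesis by (simp add: linear_sum[OF lin] linear_cmul[OF lin])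
    qed
    then show ?thesis
      by (subst linear_frame_expansion[OF assms, of w p]) (simp add: g_sym mult.commute)
  qed
  then show eq: "sharp g p \<alpha> = ?v"
    unfolding sharp_def
    by (intro the_equality allI *) (rule g_nondegenerate[of p], simp add: *)
  show "g p (sharp g p \<alpha>) w = \<alpha> w"
    unfolding eq by (rule *)
qed

lemma inverse_metric_eq: "inverse_metric g p i j = (\<Sum>c\<in>Basis. (T p c \<bullet> i) * (T p c \<bullet> j))"
proof -
  have "linear (\<lambda>w. w \<bullet> j)" by (auto intro!: linearI simp: inner_simps)
  then show ?thesis
    by (simp add: inverse_metric_def sharp_eq inner_sum_left mult.commute)
qed

text \<open>The matrix of the inverse metric is the Gram matrix of the coordinates of the frame, so a
  contraction first becomes a sum over frame vectors, and bilinearity then collects the coordinates.\<close>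

lemma contract_inverse_metric_bilinear:
  assumes "bilinear (\<rho> :: 'a \<Rightarrow> 'a \<Rightarrow> real)"
  shows "(\<Sum>i\<in>Basis. \<Sum>j\<in>Basis. inverse_metric g p i j * \<rho> i j) = (\<Sum>c\<in>Basis. \<rho> (T p c) (T p c))"
proof -
  have lin: "linear (\<rho> v)" "linear (\<lambda>v. \<rho> v w)" for v w
    using assms by (auto simp: bilinear_def)
  have exp: "\<rho> v w = (\<Sum>i\<in>Basis. \<Sum>j\<in>Basis. (v \<bullet> i) * (w \<bullet> j) * \<rho> i j)" for v w
  proof -
    have "\<rho> v w = \<rho> (\<Sum>i\<in>Basis. (v \<bullet> i) *\<^sub>R i) (\<Sum>j\<in>Basis. (w \<bullet> j) *\<^sub>R j)"
      by (simp add: euclidean_representation)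
    also have "\<dots> = (\<Sum>i\<in>Basis. \<Sum>j\<in>Basis. (v \<bullet> i) * (w \<bullet> j) * \<rho> i j)"
      by (simp only: linear_sum[OF lin(1)] linear_sum[OF lin(2)] linear_cmul[OF lin(1)]
          linear_cmul[OF lin(2)]) (subst sum.swap, simp add: sum_distrib_left mult_ac)
    finally show ?thesis .
  qed
  have "(\<Sum>i\<in>Basis. \<Sum>j\<in>Basis. inverse_metric g p i j * \<rho> i j)
     = (\<Sum>i\<in>Basis. \<Sum>j\<in>Basis. \<Sum>c\<in>Basis. (T p c \<bullet> i) * (T p c \<bullet> j) * \<rho> i j)"
    by (simp only: inverse_metric_eq sum_distrib_right)
  also have "\<dots> = (\<Sum>i\<in>Basis. \<Sum>c\<in>Basis. \<Sum>j\<in>Basis. (T p c \<bullet> i) * (T p c \<bullet> j) * \<rho> i j)"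
    by (rule sum.cong[OF refl], rule sum.swap)
  also have "\<dots> = (\<Sum>c\<in>Basis. \<Sum>i\<in>Basis. \<Sum>j\<in>Basis. (T p c \<bullet> i) * (T p c \<bullet> j) * \<rho> i j)"
    by (rule sum.swap)
  also have "\<dots> = (\<Sum>c\<in>Basis. \<rho> (T p c) (T p c))"
    by (rule sum.cong[OF refl], rule exp[symmetric])
  finally show ?thesis .
qed

lemma contract_inverse_metric:
  assumes "linear (\<alpha> :: 'a \<Rightarrow> real)" "linear (\<beta> :: 'a \<Rightarrow> real)"
  shows "(\<Sum>i\<in>Basis. \<Sum>i'\<in>Basis. inverse_metric g p i i' * (\<alpha> i * \<beta> i'))
       = (\<Sum>c\<in>Basis. \<alpha> (T p c) * \<beta> (T p c))"
proof (rule contract_inverse_metric_bilinear)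
  show "bilinear (\<lambda>i i'. \<alpha> i * \<beta> i')"
    unfolding bilinear_def using assms
    by (auto intro!: linearI simp: linear_add linear_cmul algebra_simps)
qed

lemma contract_inverse_metric2:
  assumes "bilinear (\<alpha> :: 'a \<Rightarrow> 'a \<Rightarrow> real)" "bilinear (\<beta> :: 'a \<Rightarrow> 'a \<Rightarrow> real)"
  shows "(\<Sum>i\<in>Basis. \<Sum>j\<in>Basis. \<Sum>i'\<in>Basis. \<Sum>j'\<in>Basis.
            inverse_metric g p i i' * inverse_metric g p j j' * \<alpha> i j * \<beta> i' j')
       = (\<Sum>a\<in>Basis. \<Sum>b\<in>Basis. \<alpha> (T p a) (T p b) * \<beta> (T p a) (T p b))"
proof -
  let ?h = "inverse_metric g p"
  have lin: "linear (\<alpha> i)" "linear (\<beta> i)" "linear (\<lambda>i. \<alpha> i j)" "linear (\<lambda>i. \<beta> i j)" for i j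
    using assms by (auto simp: bilinear_def)
  have "(\<Sum>i\<in>Basis. \<Sum>j\<in>Basis. \<Sum>i'\<in>Basis. \<Sum>j'\<in>Basis. ?h i i' * ?h j j' * \<alpha> i j * \<beta> i' j')
      = (\<Sum>i\<in>Basis. \<Sum>i'\<in>Basis. ?h i i' * (\<Sum>j\<in>Basis. \<Sum>j'\<in>Basis. ?h j j' * (\<alpha> i j * \<beta> i' j')))"
    by (rule sum.cong[OF refl], subst sum.swap) (simp add: sum_distrib_left mult_ac)
  also have "\<dots> = (\<Sum>i\<in>Basis. \<Sum>i'\<in>Basis. \<Sum>b\<in>Basis. ?h i i' * (\<alpha> i (T p b) * \<beta> i' (T p b)))"
    by (simp add: contract_inverse_metric lin sum_distrib_left)
  also have "\<dots> = (\<Sum>i\<in>Basis. \<Sum>b\<in>Basis. \<Sum>i'\<in>Basis. ?h i i' * (\<alpha> i (T p b) * \<beta> i' (T p b)))"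
    by (rule sum.cong[OF refl], rule sum.swap)
  also have "\<dots> = (\<Sum>b\<in>Basis. \<Sum>i\<in>Basis. \<Sum>i'\<in>Basis. ?h i i' * (\<alpha> i (T p b) * \<beta> i' (T p b)))"
    by (rule sum.swap)
  also have "\<dots> = (\<Sum>b\<in>Basis. \<Sum>a\<in>Basis. \<alpha> (T p a) (T p b) * \<beta> (T p a) (T p b))"
    by (simp add: contract_inverse_metric lin)
  also have "\<dots> = (\<Sum>a\<in>Basis. \<Sum>b\<in>Basis. \<alpha> (T p a) (T p b) * \<beta> (T p a) (T p b))"
    by (rule sum.swap)
  finally show ?thesis .
qed

lemma contract_inverse_metric4:
  assumes "\<And>x y. bilinear (\<lambda>z w. R x y z w :: real)" "\<And>z w. bilinear (\<lambda>x y. R x y z w)"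
  shows "(\<Sum>i\<in>Basis. \<Sum>j\<in>Basis. \<Sum>k\<in>Basis. \<Sum>l\<in>Basis.
      \<Sum>i'\<in>Basis. \<Sum>j'\<in>Basis. \<Sum>k'\<in>Basis. \<Sum>l'\<in>Basis.
        inverse_metric g p i i' * inverse_metric g p j j'
        * inverse_metric g p k k' * inverse_metric g p l l' * R i j k l * R i' j' k' l')
    = (\<Sum>a\<in>Basis. \<Sum>b\<in>Basis. \<Sum>c\<in>Basis. \<Sum>d\<in>Basis. (R (T p a) (T p b) (T p c) (T p d))\<^sup>2)"
    (is "?lhs = ?rhs")
proof -
  let ?h = "inverse_metric g p"
  let ?B = "Basis :: 'a set"
  have swap: "(\<Sum>k\<in>?B. \<Sum>l\<in>?B. \<Sum>i'\<in>?B. \<Sum>j'\<in>?B. f k l i' j')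
      = (\<Sum>i'\<in>?B. \<Sum>j'\<in>?B. \<Sum>k\<in>?B. \<Sum>l\<in>?B. f k l i' j')" for f :: "'a \<Rightarrow> 'a \<Rightarrow> 'a \<Rightarrow> 'a \<Rightarrow> real"
  proof -
    have "(\<Sum>k\<in>?B. \<Sum>l\<in>?B. \<Sum>i'\<in>?B. \<Sum>j'\<in>?B. f k l i' j')
        = (\<Sum>k\<in>?B. \<Sum>i'\<in>?B. \<Sum>l\<in>?B. \<Sum>j'\<in>?B. f k l i' j')"
      by (rule sum.cong[OF refl], rule sum.swap)
    also have "\<dots> = (\<Sum>i'\<in>?B. \<Sum>k\<in>?B. \<Sum>l\<in>?B. \<Sum>j'\<in>?B. f k l i' j')"
      by (rule sum.swap)
    also have "\<dots> = (\<Sum>i'\<in>?B. \<Sum>k\<in>?B. \<Sum>j'\<in>?B. \<Sum>l\<in>?B. f k l i' j')"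
      by (rule sum.cong[OF refl], rule sum.cong[OF refl], rule sum.swap)
    also have "\<dots> = (\<Sum>i'\<in>?B. \<Sum>j'\<in>?B. \<Sum>k\<in>?B. \<Sum>l\<in>?B. f k l i' j')"
      by (rule sum.cong[OF refl], rule sum.swap)
    finally show ?thesis .
  qed
  have "?lhs = (\<Sum>i\<in>?B. \<Sum>j\<in>?B. \<Sum>i'\<in>?B. \<Sum>j'\<in>?B. ?h i i' * ?h j j' *
      (\<Sum>k\<in>?B. \<Sum>l\<in>?B. \<Sum>k'\<in>?B. \<Sum>l'\<in>?B. ?h k k' * ?h l l' * R i j k l * R i' j' k' l'))"
    by (rule sum.cong[OF refl], rule sum.cong[OF refl], rule trans[OF swap])
      (simp only: sum_distrib_left mult.assoc)
  also have "\<dots> = (\<Sum>i\<in>?B. \<Sum>j\<in>?B. \<Sum>i'\<in>?B. \<Sum>j'\<in>?B. \<Sum>c\<in>?B. \<Sum>d\<in>?B.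
      ?h i i' * ?h j j' * R i j (T p c) (T p d) * R i' j' (T p c) (T p d))"
    by (simp only: contract_inverse_metric2[OF assms(1) assms(1)])
      (simp only: sum_distrib_left mult.assoc)
  also have "\<dots> = (\<Sum>i\<in>?B. \<Sum>j\<in>?B. \<Sum>c\<in>?B. \<Sum>d\<in>?B. \<Sum>i'\<in>?B. \<Sum>j'\<in>?B. 
      ?h i i' * ?h j j' * R i j (T p c) (T p d) * R i' j' (T p c) (T p d))"
    by (rule sum.cong[OF refl], rule sum.cong[OF refl], rule swap)
  also have "\<dots> = (\<Sum>c\<in>?B. \<Sum>d\<in>?B. \<Sum>i\<in>?B. \<Sum>j\<in>?B. \<Sum>i'\<in>?B. \<Sum>j'\<in>?B. 
      ?h i i' * ?h j j' * R i j (T p c) (T p d) * R i' j' (T p c) (T p d))"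
    by (rule swap)
  also have "\<dots> = (\<Sum>c\<in>?B. \<Sum>d\<in>?B. \<Sum>a\<in>?B. \<Sum>b\<in>?B. (R (T p a) (T p b) (T p c) (T p d))\<^sup>2)"
    by (simp only: contract_inverse_metric2[OF assms(2) assms(2)] power2_eq_square)
  also have "\<dots> = ?rhs"
    by (rule swap)
  finally show ?thesis .
qed

text \<open>The trace in the coordinate basis, which need not be orthonormal for \<open>g\<close>, agrees with the
  trace in the frame.\<close>

lemma trace_frame:
  assumes "linear L"
  shows "(\<Sum>b\<in>Basis. L b \<bullet> b) = (\<Sum>a\<in>Basis. g p (L (T p a)) (T p a))"
proof -
  have S_exp: "S p w = (\<Sum>b\<in>Basis. (w \<bullet> b) *\<^sub>R S p b)" for w
    by (subst euclidean_representation[of w, symmetric])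
      (simp add: linear_sum[OF linear_S] linear_cmul[OF linear_S])
  have "(\<Sum>a\<in>Basis. g p (L (T p a)) (T p a)) = (\<Sum>a\<in>Basis. \<Sum>b\<in>Basis. (L (T p a) \<bullet> b) * (S p b \<bullet> a))"
    by (intro sum.cong refl, subst g_frame, subst S_exp) (simp add: inner_sum_left)
  also have "\<dots> = (\<Sum>b\<in>Basis. \<Sum>a\<in>Basis. (L (T p a) \<bullet> b) * (S p b \<bullet> a))"
    by (rule sum.swap)
  also have "\<dots> = (\<Sum>b\<in>Basis. L b \<bullet> b)"
  proof (rule sum.cong[OF refl])
    fix b :: 'a
    have "L b = L (\<Sum>a\<in>Basis. g p b (T p a) *\<^sub>R T p a)"
      by (simp flip: frame_expansion)
    then have "L b = (\<Sum>a\<in>Basis. (S p b \<bullet> a) *\<^sub>R L (T p a))"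
      by (simp add: linear_sum[OF assms] linear_cmul[OF assms] g_frame)
    then show "(\<Sum>a\<in>Basis. (L (T p a) \<bullet> b) * (S p b \<bullet> a)) = L b \<bullet> b"
      by (simp add: inner_sum_left mult.commute)
  qed
  finally show ?thesis by simp
qed


end

section \<open>The curvature in terms of second derivatives of the metric\<close>

text \<open>The functions \<open>g1\<close> and \<open>g2\<close> are the first and second derivatives of the metric
  coefficients; in \<open>g2 p X Y V W\<close> the direction of the last differentiation is \<open>X\<close>.\<close>

locale C2_coframe_metric = coframe_metric S T g
  for S T :: "'a::euclidean_space \<Rightarrow> 'a \<Rightarrow> 'a" and g :: "'a metric" +
  fixes g1 :: "'a \<Rightarrow> 'a \<Rightarrow> 'a \<Rightarrow> 'a \<Rightarrow> real" and g2 :: "'a \<Rightarrow> 'a \<Rightarrow> 'a \<Rightarrow> 'a \<Rightarrow> 'a \<Rightarrow> real"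
  assumes g1: "((\<lambda>q. g q V W) has_derivative (\<lambda>X. g1 p X V W)) (at p)"
    and g2: "((\<lambda>q. g1 q Y V W) has_derivative (\<lambda>X. g2 p X Y V W)) (at p)"
    and g2_commute: "g2 p X Y V W = g2 p Y X V W"
    and T_differentiable: "(\<lambda>q. T q c) differentiable (at p)"
begin

text \<open>The Christoffel symbols of the first kind.\<close>

definition lowered :: "'a \<Rightarrow> 'a \<Rightarrow> 'a \<Rightarrow> 'a \<Rightarrow> real" where
  "lowered p X Y Z = (g1 p X Y Z + g1 p Y X Z - g1 p Z X Y) / 2"

lemma g1_sym: "g1 p X V W = g1 p X W V"
  using has_derivative_unique[OF g1[of V W p], of "\<lambda>X. g1 p X W V"] g1[of W V p]
  by (simp add: g_sym fun_eq_iff)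

lemma linear_g1:
  "linear (\<lambda>X. g1 p X V W)" "linear (\<lambda>V. g1 p X V W)" "linear (\<lambda>W. g1 p X V W)"
proof -
  show "linear (\<lambda>X. g1 p X V W)"
    using g1 has_derivative_linear by blast
  have lin: "linear (\<lambda>V. g q V W)" for q W
    using bilinear_g[of q] by (simp add: bilinear_def)
  show *: "linear (\<lambda>V. g1 p X V W)" for W
  proof (rule linearI)
    fix V V' and r :: real
    have "((\<lambda>q. g q (V + V') W) has_derivative (\<lambda>X. g1 p X V W + g1 p X V' W)) (at p)"
      unfolding linear_add[OF lin] by (intro has_derivative_add g1)
    from has_derivative_unique[OF g1 this] show "g1 p X (V + V') W = g1 p X V W + g1 p X V' W"
      by (rule fun_cong)
    have "((\<lambda>q. g q (r *\<^sub>R V) W) has_derivative (\<lambda>X. r *\<^sub>R g1 p X V W)) (at p)"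
      unfolding linear_cmul[OF lin] by (intro has_derivative_scaleR_right g1)
    from has_derivative_unique[OF g1 this] show "g1 p X (r *\<^sub>R V) W = r *\<^sub>R g1 p X V W"
      by (rule fun_cong)
  qed
  show "linear (\<lambda>W. g1 p X V W)"
    using *[of V] by (simp add: g1_sym[of p X V])
qed

lemma g2_sym: "g2 p X Y V W = g2 p X Y W V"
  using has_derivative_unique[OF g2[of Y V W p], of "\<lambda>X. g2 p X Y W V"] g2[of Y W V p]
  by (simp add: g1_sym[of _ _ V W] fun_eq_iff)

lemma linear_g2:
  "linear (\<lambda>X. g2 p X Y V W)" "linear (\<lambda>Y. g2 p X Y V W)" "linear (\<lambda>V. g2 p X Y V W)"
  "linear (\<lambda>W. g2 p X Y V W)"
proof -
  show *: "linear (\<lambda>X. g2 p X Y V W)" for Y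
    using g2 has_derivative_linear by blast
  show "linear (\<lambda>Y. g2 p X Y V W)"
    using *[of X] by (simp add: g2_commute[of p X])
  show **: "linear (\<lambda>V. g2 p X Y V W)" for W
  proof (rule linearI)
    fix V V' and r :: real
    have "((\<lambda>q. g1 q Y (V + V') W) has_derivative (\<lambda>X. g2 p X Y V W + g2 p X Y V' W)) (at p)"
      unfolding linear_add[OF linear_g1(2)] by (intro has_derivative_add g2)
    from has_derivative_unique[OF g2 this]
    show "g2 p X Y (V + V') W = g2 p X Y V W + g2 p X Y V' W"
      by (rule fun_cong)
    have "((\<lambda>q. g1 q Y (r *\<^sub>R V) W) has_derivative (\<lambda>X. r *\<^sub>R g2 p X Y V W)) (at p)"
      unfolding linear_cmul[OF linear_g1(2)] by (intro has_derivative_scaleR_right g2)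
    from has_derivative_unique[OF g2 this] show "g2 p X Y (r *\<^sub>R V) W = r *\<^sub>R g2 p X Y V W"
      by (rule fun_cong)
  qed
  show "linear (\<lambda>W. g2 p X Y V W)"
    using **[of V] by (simp add: g2_sym[of p X Y V])
qed

lemma linear_lowered:
  "linear (\<lambda>X. lowered p X Y Z)" "linear (\<lambda>Y. lowered p X Y Z)" "linear (\<lambda>Z. lowered p X Y Z)"
  unfolding lowered_def
  by (auto intro!: linearI simp: linear_add[OF linear_g1(1)] linear_add[OF linear_g1(2)]
      linear_add[OF linear_g1(3)] linear_cmul[OF linear_g1(1)] linear_cmul[OF linear_g1(2)]
      linear_cmul[OF linear_g1(3)] field_simps)

text \<open>Compatibility of the connection with the metric, which turns derivatives of the metric in
  the curvature into Christoffel symbols.\<close>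

lemma lowered_compatible: "g1 p X U W = lowered p X U W + lowered p X W U"
  by (simp add: lowered_def g1_sym[of p _ W U] g1_sym[of p _ W X] g1_sym[of p _ U X] field_simps)

lemma christoffel_sharp: "christoffel g p X Y = sharp g p (lowered p X Y)"
proof -
  have "frechet_derivative (\<lambda>q. g q V W) (at p) = (\<lambda>X. g1 p X V W)" for V W
    using frechet_derivative_at[OF g1] by simp
  then show ?thesis
    by (simp add: christoffel_def lowered_def[abs_def])
qed

lemma g_christoffel: "g p (christoffel g p X Y) W = lowered p X Y W"
  by (simp add: christoffel_sharp g_sharp linear_lowered(3))

lemma christoffel_frame:
  "christoffel g p X Y = (\<Sum>c\<in>Basis. lowered p X Y (T p c) *\<^sub>R T p c)"
  by (simp add: christoffel_sharp sharp_eq linear_lowered(3))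

lemma has_derivative_metric_applied:
  assumes "(v has_derivative v') (at p)"
  shows "((\<lambda>q. g q (v q) W) has_derivative (\<lambda>X. g p (v' X) W + g1 p X (v p) W)) (at p)"
proof -
  have exp: "f u = (\<Sum>i\<in>Basis. (u \<bullet> i) * f i)" if "linear f" for f :: "'a \<Rightarrow> real" and u
    by (subst euclidean_representation[of u, symmetric])
      (simp only: linear_sum[OF that] linear_cmul[OF that] real_scaleR_def)
  have lin: "linear (\<lambda>V. g q V W)" for q
    using bilinear_g[of q] by (simp add: bilinear_def)
  have "((\<lambda>q. \<Sum>i\<in>Basis. (v q \<bullet> i) * g q i W) has_derivative
      (\<lambda>X. \<Sum>i\<in>Basis. (v p \<bullet> i) * g1 p X i W + (v' X \<bullet> i) * g p i W)) (at p)"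
    by (intro has_derivative_sum has_derivative_mult g1 has_derivative_inner_left assms)
  then show ?thesis
    by (simp add: sum.distrib add.commute flip: exp[OF lin] exp[OF linear_g1(2)])
qed

text \<open>In the frame the Christoffel vector is a sum of products of differentiable functions, so no
  derivative of an inverse matrix is needed.\<close>

lemma christoffel_differentiable: "(\<lambda>q. christoffel g q X Y) differentiable (at p)"
proof -
  have exp: "g1 q U V (T q c) = (\<Sum>i\<in>Basis. (T q c \<bullet> i) * g1 q U V i)"
            "g1 q (T q c) U V = (\<Sum>i\<in>Basis. (T q c \<bullet> i) * g1 q i U V)" for U V q c
    by (subst (1) euclidean_representation[of "T q c", symmetric],
        simp only: linear_sum[OF linear_g1(3)] linear_cmul[OF linear_g1(3)]
          linear_sum[OF linear_g1(1)] linear_cmul[OF linear_g1(1)] real_scaleR_def)+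
  have "(\<lambda>q. g1 q U V W) differentiable (at p)" for U V W
    using g2 differentiableI by blast
  then show ?thesis
    unfolding christoffel_frame lowered_def exp
    using T_differentiable
    by (auto intro!: differentiable_sum differentiable_scaleR derivative_intros)
qed

text \<open>The classical formula for the fully covariant curvature tensor.  Its value is that it only
  involves evaluations of \<open>g1\<close> and \<open>g2\<close> on frame vectors; differentiating \<open>g (\<Gamma> Y Z) W\<close>
  instead of \<open>\<Gamma> Y Z\<close> avoids any derivative of the frame itself.\<close>

lemma riemann_eq:
  "riemann g p X Y Z W = (g2 p X Z Y W - g2 p X W Y Z - g2 p Y Z X W + g2 p Y W X Z) / 2
     + (\<Sum>c\<in>Basis. lowered p X Z (T p c) * lowered p Y W (T p c)
                 - lowered p X W (T p c) * lowered p Y Z (T p c))"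
proof -
  let ?G = "christoffel g p"
  define D where "D Y Z = frechet_derivative (\<lambda>q. christoffel g q Y Z) (at p)" for Y Z
  have D: "((\<lambda>q. christoffel g q Y Z) has_derivative D Y Z) (at p)" for Y Z
    using christoffel_differentiable unfolding D_def by (simp add: frechet_derivative_works)
  have gD: "g p (D Y Z X) W = (g2 p X Y Z W + g2 p X Z Y W - g2 p X W Y Z) / 2
      - lowered p X (?G Y Z) W - lowered p X W (?G Y Z)" for X Y Z W
  proof -
    have "((\<lambda>q. lowered q Y Z W) has_derivative (\<lambda>X. g p (D Y Z X) W + g1 p X (?G Y Z) W)) (at p)"
      using has_derivative_metric_applied[OF D[of Y Z], of W] by (simp add: g_christoffel)
    moreover have "((\<lambda>q. lowered q Y Z W) has_derivative
        (\<lambda>X. (g2 p X Y Z W + g2 p X Z Y W - g2 p X W Y Z) / 2)) (at p)"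
      unfolding lowered_def
      by (intro bounded_linear.has_derivative[OF bounded_linear_divide] has_derivative_add
          has_derivative_diff g2)
    ultimately have "(\<lambda>X. g p (D Y Z X) W + g1 p X (?G Y Z) W)
        = (\<lambda>X. (g2 p X Y Z W + g2 p X Z Y W - g2 p X W Y Z) / 2)"
      by (rule has_derivative_unique)
    then show ?thesis
      by (metis (no_types, lifting) lowered_compatible add_diff_cancel_right' diff_diff_eq)
  qed
  have "linear (\<lambda>X. christoffel g p X Z)"
    by (rule linearI)
      (simp_all add: christoffel_frame linear_add[OF linear_lowered(1)]
        linear_cmul[OF linear_lowered(1)] sum.distrib scaleR_sum_right scaleR_left_distrib)
  from linear_0[OF this] have "curvature g (\<lambda>_. X) (\<lambda>_. Y) (\<lambda>_. Z) p
      = (D Y Z X + ?G X (?G Y Z)) - (D X Z Y + ?G Y (?G X Z))"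
    by (simp add: curvature_def nabla_def lie_bracket_def D_def frechet_derivative_const)
  moreover have lin: "linear (\<lambda>v. g p v W)"
    using bilinear_g[of p] by (simp add: bilinear_def)
  ultimately have "riemann g p X Y Z W = (g p (D Y Z X) W + g p (?G X (?G Y Z)) W)
      - (g p (D X Z Y) W + g p (?G Y (?G X Z)) W)"
    by (simp add: riemann_def linear_add[OF lin] linear_diff[OF lin])
  also have "\<dots> = (g2 p X Z Y W - g2 p X W Y Z - g2 p Y Z X W + g2 p Y W X Z) / 2
      + (lowered p Y W (?G X Z) - lowered p X W (?G Y Z))"
    by (simp add: gD g_christoffel g2_commute[of p X Y] field_simps)
  finally have *: "riemann g p X Y Z W = \<dots>" .
  have "lowered p Y W (?G X Z) = (\<Sum>c\<in>Basis. lowered p X Z (T p c) * lowered p Y W (T p c))"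
    for X Y Z W
    by (subst linear_frame_expansion[OF linear_lowered(3), of p Y W "?G X Z" p])
      (simp add: g_christoffel)
  then show ?thesis
    by (simp add: * sum_subtractf mult.commute)
qed

lemma linear_riemann:
  "linear (\<lambda>X. riemann g p X Y Z W)" "linear (\<lambda>Y. riemann g p X Y Z W)"
  "linear (\<lambda>Z. riemann g p X Y Z W)" "linear (\<lambda>W. riemann g p X Y Z W)"
  unfolding riemann_eq
  by (auto intro!: linearI simp: linear_add[OF linear_g2(1)] linear_add[OF linear_g2(2)]
      linear_add[OF linear_g2(3)] linear_add[OF linear_g2(4)] linear_cmul[OF linear_g2(1)]
      linear_cmul[OF linear_g2(2)] linear_cmul[OF linear_g2(3)] linear_cmul[OF linear_g2(4)]
      linear_add[OF linear_lowered(1)] linear_add[OF linear_lowered(2)]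
      linear_cmul[OF linear_lowered(1)] linear_cmul[OF linear_lowered(2)]
      sum.distrib[symmetric] sum_subtractf[symmetric] sum_distrib_left algebra_simps add_divide_distrib diff_divide_distrib)

lemma ricci_frame: "ricci g p Y Z = (\<Sum>a\<in>Basis. riemann g p (T p a) Y Z (T p a))"
proof -
  let ?L = "\<lambda>b. curvature g (\<lambda>_. b) (\<lambda>_. Y) (\<lambda>_. Z) p"
  have lin: "linear (\<lambda>v. g p v W)" for W
    using bilinear_g[of p] by (simp add: bilinear_def)
  have "linear ?L"
    by (rule linearI; rule g_nondegenerate[of p])
      (simp_all only: linear_add[OF lin] linear_cmul[OF lin] flip: riemann_def,
        simp_all only: linear_add[OF linear_riemann(1)] linear_cmul[OF linear_riemann(1)])
  then show ?thesis
    unfolding ricci_def riemann_def by (rule trace_frame)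
qed

lemma bilinear_ricci: "bilinear (ricci g p)"
  unfolding bilinear_def ricci_frame
  by (auto intro!: linearI simp: linear_add[OF linear_riemann(2)] linear_cmul[OF linear_riemann(2)]
      linear_add[OF linear_riemann(3)] linear_cmul[OF linear_riemann(3)] sum.distrib sum_distrib_left)

lemma scalar_curvature_frame: "scalar_curvature g p = (\<Sum>a\<in>Basis. ricci g p (T p a) (T p a))"
  unfolding scalar_curvature_def by (rule contract_inverse_metric_bilinear[OF bilinear_ricci])

lemma ricci_norm_sq_frame:
  "ricci_norm_sq g p = (\<Sum>a\<in>Basis. \<Sum>b\<in>Basis. (ricci g p (T p a) (T p b))\<^sup>2)"
  unfolding ricci_norm_sq_def
  by (simp only: contract_inverse_metric2[OF bilinear_ricci bilinear_ricci] power2_eq_square)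

lemma riemann_norm_sq_frame:
  "riemann_norm_sq g p = (\<Sum>a\<in>Basis. \<Sum>b\<in>Basis. \<Sum>c\<in>Basis. \<Sum>d\<in>Basis.
     (riemann g p (T p a) (T p b) (T p c) (T p d))\<^sup>2)"
  unfolding riemann_norm_sq_def
  by (rule contract_inverse_metric4) (simp_all add: bilinear_def linear_riemann)

end

section \<open>Sheared product metrics\<close>

text \<open>Let a metric have the form \<open>|Y|\<^sup>2 + |W - A Y|\<^sup>2\<close> on a product.  In the frame adapted to it,
  the first and second derivatives of its coefficients only depend on the first and second
  derivatives \<open>\<alpha>\<close> and \<open>\<beta>\<close> of \<open>A\<close> along the frame vectors, by the formulas \<open>jet1\<close> and
  \<open>jet2\<close> with \<open>t = 1\<close>.  The parameter \<open>t\<close> weighs the terms quadratic in \<open>\<alpha>\<close> against those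
  linear in \<open>\<beta>\<close>: replacing \<open>\<beta>\<close> by \<open>\<beta> / t\<close> and multiplying the curvature by \<open>t\<close> gives an
  expression which still makes sense at \<open>t = 0\<close>.\<close>

definition jet1 :: "('e \<times> 'f \<Rightarrow> 'e \<Rightarrow> 'f) \<Rightarrow> 'e \<times> 'f \<Rightarrow> 'e::euclidean_space \<times> 'f::euclidean_space \<Rightarrow> 'e \<times> 'f \<Rightarrow> real"
  where "jet1 \<alpha> X V W = - (\<alpha> X (fst V) \<bullet> snd W) - snd V \<bullet> \<alpha> X (fst W)"

definition jet2 ::
    "real \<Rightarrow> ('e \<times> 'f \<Rightarrow> 'e \<Rightarrow> 'f) \<Rightarrow> ('e \<times> 'f \<Rightarrow> 'e \<times> 'f \<Rightarrow> 'e \<Rightarrow> 'f)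
      \<Rightarrow> 'e \<times> 'f \<Rightarrow> 'e \<times> 'f \<Rightarrow> 'e::euclidean_space \<times> 'f::euclidean_space \<Rightarrow> 'e \<times> 'f \<Rightarrow> real"
  where "jet2 t \<alpha> \<beta> X Y V W = - (\<beta> X Y (fst V) \<bullet> snd W) - snd V \<bullet> \<beta> X Y (fst W)
      + t * (\<alpha> Y (fst V) \<bullet> \<alpha> X (fst W) + \<alpha> X (fst V) \<bullet> \<alpha> Y (fst W))"

definition jet_lowered ::
    "('e \<times> 'f \<Rightarrow> 'e \<Rightarrow> 'f) \<Rightarrow> 'e \<times> 'f \<Rightarrow> 'e::euclidean_space \<times> 'f::euclidean_space \<Rightarrow> 'e \<times> 'f \<Rightarrow> real"
  where "jet_lowered \<alpha> X Y Z = (jet1 \<alpha> X Y Z + jet1 \<alpha> Y X Z - jet1 \<alpha> Z X Y) / 2"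

definition jet_riemann ::
    "real \<Rightarrow> ('e \<times> 'f \<Rightarrow> 'e \<Rightarrow> 'f) \<Rightarrow> ('e \<times> 'f \<Rightarrow> 'e \<times> 'f \<Rightarrow> 'e \<Rightarrow> 'f)
      \<Rightarrow> 'e \<times> 'f \<Rightarrow> 'e \<times> 'f \<Rightarrow> 'e::euclidean_space \<times> 'f::euclidean_space \<Rightarrow> 'e \<times> 'f \<Rightarrow> real"
  where "jet_riemann t \<alpha> \<beta> X Y Z W =
     (jet2 t \<alpha> \<beta> X Z Y W - jet2 t \<alpha> \<beta> X W Y Z - jet2 t \<alpha> \<beta> Y Z X W + jet2 t \<alpha> \<beta> Y W X Z) / 2
     + t * (\<Sum>c\<in>Basis. jet_lowered \<alpha> X Z c * jet_lowered \<alpha> Y W c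
                     - jet_lowered \<alpha> X W c * jet_lowered \<alpha> Y Z c)"

text \<open>The integrand of the second heat invariant in terms of the components of a curvature tensor
  in an orthonormal frame.\<close>

definition quadratic_invariant :: "('a::euclidean_space \<Rightarrow> 'a \<Rightarrow> 'a \<Rightarrow> 'a \<Rightarrow> real) \<Rightarrow> real" where
  "quadratic_invariant R =
     5 * (\<Sum>a\<in>Basis. \<Sum>c\<in>Basis. R c a a c)\<^sup>2
     - 2 * (\<Sum>a\<in>Basis. \<Sum>b\<in>Basis. (\<Sum>c\<in>Basis. R c a b c)\<^sup>2)
     + 2 * (\<Sum>a\<in>Basis. \<Sum>b\<in>Basis. \<Sum>c\<in>Basis. \<Sum>d\<in>Basis. (R a b c d)\<^sup>2)"

definition a2_density :: "'a::euclidean_space metric \<Rightarrow> 'a \<Rightarrow> real" where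
  "a2_density g p = 5 * (scalar_curvature g p)\<^sup>2 - 2 * ricci_norm_sq g p + 2 * riemann_norm_sq g p"

lemma (in C2_coframe_metric) a2_density_frame:
  "a2_density g p = quadratic_invariant (\<lambda>a b c d. riemann g p (T p a) (T p b) (T p c) (T p d))"
  unfolding a2_density_def quadratic_invariant_def scalar_curvature_frame ricci_norm_sq_frame
    riemann_norm_sq_frame ricci_frame ..

lemma quadratic_invariant_scale:
  "quadratic_invariant (\<lambda>a b c d. r * R a b c d) = r\<^sup>2 * quadratic_invariant R"
proof -
  have "(\<Sum>a\<in>Basis. \<Sum>c\<in>Basis. r * R c a a c)\<^sup>2 = r\<^sup>2 * (\<Sum>a\<in>Basis. \<Sum>c\<in>Basis. R c a a c)\<^sup>2"
    by (simp add: power_mult_distrib flip: sum_distrib_left)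
  moreover have "(\<Sum>a\<in>Basis. \<Sum>b\<in>Basis. (\<Sum>c\<in>Basis. r * R c a b c)\<^sup>2)
      = r\<^sup>2 * (\<Sum>a\<in>Basis. \<Sum>b\<in>Basis. (\<Sum>c\<in>Basis. R c a b c)\<^sup>2)"
    by (simp add: power_mult_distrib flip: sum_distrib_left)
  moreover have "(\<Sum>a\<in>Basis. \<Sum>b\<in>Basis. \<Sum>c\<in>Basis. \<Sum>d\<in>Basis. (r * R a b c d)\<^sup>2)
      = r\<^sup>2 * (\<Sum>a\<in>Basis. \<Sum>b\<in>Basis. \<Sum>c\<in>Basis. \<Sum>d\<in>Basis. (R a b c d)\<^sup>2)"
    by (simp add: power_mult_distrib flip: sum_distrib_left)
  ultimately show ?thesis
    unfolding quadratic_invariant_def by (simp only:) (simp add: algebra_simps)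
qed

lemma jet_riemann_scale:
  assumes "t \<noteq> 0"
  shows "t * jet_riemann 1 \<alpha> (\<lambda>X Y b. (1 / t) *\<^sub>R \<beta> X Y b) X Y Z W = jet_riemann t \<alpha> \<beta> X Y Z W"
proof -
  have "t * jet2 1 \<alpha> (\<lambda>X Y b. (1 / t) *\<^sub>R \<beta> X Y b) X Y V W = jet2 t \<alpha> \<beta> X Y V W" for X Y V W
    using assms by (simp add: jet2_def algebra_simps)
  then show ?thesis
    unfolding jet_riemann_def by (simp flip: add: algebra_simps)
qed

definition shear_metric :: "('e::euclidean_space \<times> 'f::euclidean_space \<Rightarrow> 'e \<Rightarrow> 'f) \<Rightarrow> ('e \<times> 'f) metric" where
  "shear_metric A p V W =
     fst V \<bullet> fst W + (snd V - A p (fst V)) \<bullet> (snd W - A p (fst W))"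

definition shear_coframe :: "('e::euclidean_space \<times> 'f::euclidean_space \<Rightarrow> 'e \<Rightarrow> 'f) \<Rightarrow> 'e \<times> 'f \<Rightarrow> 'e \<times> 'f \<Rightarrow> 'e \<times> 'f" where
  "shear_coframe A p V = (fst V, snd V - A p (fst V))"

definition shear_frame :: "('e::euclidean_space \<times> 'f::euclidean_space \<Rightarrow> 'e \<Rightarrow> 'f) \<Rightarrow> 'e \<times> 'f \<Rightarrow> 'e \<times> 'f \<Rightarrow> 'e \<times> 'f" where
  "shear_frame A p V = (fst V, snd V + A p (fst V))"

lemma coframe_metric_shear:
  assumes "\<And>p. linear (A p)"
  shows "coframe_metric (shear_coframe A) (shear_frame A) (shear_metric A)"
  by unfold_locales
    (auto intro!: linearI simp: shear_coframe_def shear_frame_def shear_metric_def inner_prod_def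
      linear_add[OF assms] linear_cmul[OF assms] algebra_simps)

text \<open>Here \<open>A1\<close> and \<open>A2\<close> are the first two derivatives of the connection form \<open>A\<close>; again the
  last differentiation in \<open>A2 p X Y\<close> is in direction \<open>X\<close>.\<close>

locale C2_shear =
  fixes A :: "'e::euclidean_space \<times> 'f::euclidean_space \<Rightarrow> 'e \<Rightarrow> 'f"
    and A1 :: "'e \<times> 'f \<Rightarrow> 'e \<times> 'f \<Rightarrow> 'e \<Rightarrow> 'f"
    and A2 :: "'e \<times> 'f \<Rightarrow> 'e \<times> 'f \<Rightarrow> 'e \<times> 'f \<Rightarrow> 'e \<Rightarrow> 'f"
  assumes linear_A: "linear (A p)"
    and A1: "((\<lambda>q. A q b) has_derivative (\<lambda>X. A1 p X b)) (at p)"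
    and A2: "((\<lambda>q. A1 q Y b) has_derivative (\<lambda>X. A2 p X Y b)) (at p)"
    and A2_commute: "A2 p X Y b = A2 p Y X b"
    and continuous_A2: "continuous_on UNIV (\<lambda>p. A2 p X Y b)"
begin

sublocale C2_coframe_metric "shear_coframe A" "shear_frame A" "shear_metric A"
  "\<lambda>p X V W. - (A1 p X (fst V) \<bullet> (snd W - A p (fst W))) - (snd V - A p (fst V)) \<bullet> A1 p X (fst W)"
  "\<lambda>p X Y V W. - (A2 p X Y (fst V) \<bullet> (snd W - A p (fst W))) - (snd V - A p (fst V)) \<bullet> A2 p X Y (fst W)
      + (A1 p Y (fst V) \<bullet> A1 p X (fst W) + A1 p X (fst V) \<bullet> A1 p Y (fst W))"
proof (intro C2_coframe_metric.intro coframe_metric_shear linear_A C2_coframe_metric_axioms.intro)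
  fix p X Y V W and c :: "'e \<times> 'f"
  show "((\<lambda>q. shear_metric A q V W) has_derivative
      (\<lambda>X. - (A1 p X (fst V) \<bullet> (snd W - A p (fst W))) - (snd V - A p (fst V)) \<bullet> A1 p X (fst W))) (at p)"
    unfolding shear_metric_def
    by (auto intro!: derivative_eq_intros A1 simp: inner_commute)
  show "((\<lambda>q. - (A1 q Y (fst V) \<bullet> (snd W - A q (fst W))) - (snd V - A q (fst V)) \<bullet> A1 q Y (fst W))
      has_derivative (\<lambda>X. - (A2 p X Y (fst V) \<bullet> (snd W - A p (fst W)))
        - (snd V - A p (fst V)) \<bullet> A2 p X Y (fst W)
        + (A1 p Y (fst V) \<bullet> A1 p X (fst W) + A1 p X (fst V) \<bullet> A1 p Y (fst W)))) (at p)"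
    by (auto intro!: derivative_eq_intros A1 A2 simp: inner_simps inner_commute)
  show "(\<lambda>q. shear_frame A q c) differentiable (at p)"
    unfolding shear_frame_def
    by (intro differentiable_Pair differentiable_add differentiable_const differentiableI[OF A1])
qed (simp add: A2_commute)

lemma riemann_shear_frame:
  fixes p
  defines "T \<equiv> shear_frame A p"
  shows "riemann (shear_metric A) p (T X) (T Y) (T Z) (T W)
       = jet_riemann 1 (\<lambda>X. A1 p (T X)) (\<lambda>X Y. A2 p (T X) (T Y)) X Y Z W"
  unfolding T_def riemann_eq jet_riemann_def jet2_def jet_lowered_def jet1_def lowered_def
  by (simp add: shear_frame_def)

lemma a2_density_shear:
  fixes p
  defines "T \<equiv> shear_frame A p"
  shows "a2_density (shear_metric A) p
       = quadratic_invariant (jet_riemann 1 (\<lambda>X. A1 p (T X)) (\<lambda>X Y. A2 p (T X) (T Y)))"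
  unfolding a2_density_frame T_def riemann_shear_frame ..

end

section \<open>The volume form\<close>

text \<open>Transports the Leibniz formula from permutations of \<open>Basis\<close> to permutations of an index type,
  where determinants are multiplicative.\<close>

lemma metric_det_eq_det:
  fixes e :: "'n::finite \<Rightarrow> 'a::euclidean_space"
  assumes "bij_betw e UNIV Basis"
  shows "metric_det g p = det (\<chi> i j. g p (e i) (e j))"
proof -
  let ?m = "map_permutation UNIV e"
  have inj: "inj_on e UNIV" and "e ` UNIV = Basis"
    using assms by (auto simp: bij_betw_def)
  have bij: "bij_betw ?m {\<pi>. \<pi> permutes UNIV} {\<pi>. \<pi> permutes Basis}"
  proof (rule bij_betw_byWitness[where f' = "map_permutation Basis (inv_into UNIV e)"])
    have inv: "bij_betw (inv_into UNIV e) Basis UNIV"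
      by (rule bij_betw_inv_into[OF assms])
    show "\<forall>\<pi>\<in>{\<pi>. \<pi> permutes UNIV}. map_permutation Basis (inv_into UNIV e) (?m \<pi>) = \<pi>"
      using map_permutation_compose_inv[OF assms, of _ "inv_into UNIV e"] inj by simp
    show "\<forall>\<pi>\<in>{\<pi>. \<pi> permutes Basis}. ?m (map_permutation Basis (inv_into UNIV e) \<pi>) = \<pi>"
      using map_permutation_compose_inv[OF inv, of _ e] \<open>e ` UNIV = Basis\<close>
      by (simp add: f_inv_into_f)
    show "?m ` {\<pi>. \<pi> permutes UNIV} \<subseteq> {\<pi>. \<pi> permutes Basis}"
      using map_permutation_permutes[OF assms] by auto
    show "map_permutation Basis (inv_into UNIV e) ` {\<pi>. \<pi> permutes Basis} \<subseteq> {\<pi>. \<pi> permutes UNIV}"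
      using map_permutation_permutes[OF inv] by auto
  qed
  have "metric_det g p = (\<Sum>\<pi> | \<pi> permutes UNIV. of_int (sign (?m \<pi>)) * (\<Prod>b\<in>Basis. g p b (?m \<pi> b)))"
    unfolding metric_det_def by (rule sum.reindex_bij_betw[OF bij, symmetric])
  also have "\<dots> = (\<Sum>\<pi> | \<pi> permutes UNIV. of_int (sign \<pi>) * (\<Prod>i\<in>UNIV. g p (e i) (e (\<pi> i))))"
  proof (rule sum.cong[OF refl])
    fix \<pi> :: "'n \<Rightarrow> 'n" assume "\<pi> \<in> {\<pi>. \<pi> permutes UNIV}"
    then have "sign (?m \<pi>) = sign \<pi>"
      using inj by (intro sign_map_permutation) auto
    moreover have "(\<Prod>b\<in>Basis. g p b (?m \<pi> b)) = (\<Prod>i\<in>UNIV. g p (e i) (e (\<pi> i)))"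
      by (subst prod.reindex_bij_betw[OF assms, symmetric])
        (simp add: map_permutation_apply[OF inj])
    ultimately show "of_int (sign (?m \<pi>)) * (\<Prod>b\<in>Basis. g p b (?m \<pi> b))
        = of_int (sign \<pi>) * (\<Prod>i\<in>UNIV. g p (e i) (e (\<pi> i)))"
      by simp
  qed
  finally show ?thesis
    by (simp add: det_def)
qed

text \<open>The volume form is Euclidean.  The shear \<open>S\<close> satisfies \<open>D S = S S D\<close> for the map \<open>D\<close>
  which doubles the fibre coordinate, hence \<open>det S = (det S)\<^sup>2\<close>; this replaces an ordering of
  the basis which would make \<open>S\<close> triangular.\<close>

lemma metric_det_shear:
  fixes A :: "'e::euclidean_space \<times> 'f::euclidean_space \<Rightarrow> 'e \<Rightarrow> 'f"
  assumes lin: "\<And>p. linear (A p)" and card: "CARD('n::finite) = DIM('e \<times> 'f)"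
  shows "metric_det (shear_metric A) p = 1"
proof -
  obtain e :: "'n \<Rightarrow> 'e \<times> 'f" where e: "bij_betw e UNIV Basis"
    using finite_same_card_bij[of "UNIV :: 'n set" "Basis :: ('e \<times> 'f) set"] card by auto
  define M :: "('e \<times> 'f \<Rightarrow> 'e \<times> 'f) \<Rightarrow> real^'n^'n" where "M f = (\<chi> i j. f (e j) \<bullet> e i)" for f
  have parseval: "v \<bullet> w = (\<Sum>k\<in>UNIV. (v \<bullet> e k) * (w \<bullet> e k))" for v w
    by (subst euclidean_inner) (rule sum.reindex_bij_betw[OF e, symmetric])
  have expand: "v = (\<Sum>k\<in>UNIV. (v \<bullet> e k) *\<^sub>R e k)" for v
    using sum.reindex_bij_betw[OF e, of "\<lambda>b. (v \<bullet> b) *\<^sub>R b"] by (simp add: euclidean_representation)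
  have det_comp: "det (M (f \<circ> h)) = det (M f) * det (M h)" if "linear f" for f h
  proof -
    have "f (h (e j)) \<bullet> e i = (\<Sum>k\<in>UNIV. (f (e k) \<bullet> e i) * (h (e j) \<bullet> e k))" for i j
      by (subst expand[of "h (e j)"])
        (simp add: linear_sum[OF that] linear_cmul[OF that] inner_sum_left mult.commute)
    then have "M (f \<circ> h) = M f ** M h"
      by (simp add: M_def matrix_matrix_mult_def vec_eq_iff)
    then show ?thesis by (simp add: det_mul)
  qed
  have "e i \<in> Basis" for i using e by (auto simp: bij_betw_def)
  moreover have "e i = e j \<longleftrightarrow> i = j" for i j
    using e by (auto simp: bij_betw_def inj_on_def)
  ultimately have "M id = mat 1"
    by (auto simp: M_def mat_def vec_eq_iff inner_Basis)
  then have det_id: "det (M id) = 1" by simp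
  define S where "S = shear_coframe A p"
  define D :: "'e \<times> 'f \<Rightarrow> 'e \<times> 'f" where "D v = (fst v, 2 *\<^sub>R snd v)" for v
  have linS: "linear S" and linD: "linear D" and linSS: "linear (S \<circ> S)"
    unfolding S_def D_def shear_coframe_def
    by (auto intro!: linearI simp: linear_add[OF lin] linear_cmul[OF lin] algebra_simps)
  have "D \<circ> (\<lambda>v. (fst v, (1/2) *\<^sub>R snd v)) = id" "S \<circ> shear_frame A p = id"
    by (auto simp: D_def S_def shear_coframe_def shear_frame_def fun_eq_iff)
  with det_comp[OF linD] det_comp[OF linS] det_id have "det (M D) \<noteq> 0" "det (M S) \<noteq> 0"
    by (metis mult_zero_left zero_neq_one)+
  moreover have "D \<circ> S = (S \<circ> S) \<circ> D"
    by (auto simp: D_def S_def shear_coframe_def fun_eq_iff algebra_simps scaleR_2)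
  then have "det (M (D \<circ> S)) = det (M ((S \<circ> S) \<circ> D))"
    by (rule arg_cong)
  then have "det (M D) * det (M S) = det (M S) * det (M S) * det (M D)"
    unfolding det_comp[OF linD] det_comp[OF linSS] det_comp[OF linS] .
  ultimately have "det (M S) = 1" by simp
  moreover have "(\<chi> i j. shear_metric A p (e i) (e j)) = transpose (M S) ** M S"
  proof -
    have "shear_metric A p v w = S v \<bullet> S w" for v w
      by (simp add: shear_metric_def S_def shear_coframe_def inner_prod_def)
    then show ?thesis
      unfolding M_def matrix_matrix_mult_def transpose_def vec_eq_iff
      by (auto intro: parseval)
  qed
  ultimately show ?thesis
    by (simp add: metric_det_eq_det[OF e] det_mul det_transpose)
qed

section \<open>Shrinking the fibres\<close>

text \<open>Up to the rescaling of the fibre, this is \<open>t = 1 / s\<close> times the frame adapted to the connection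
  form \<open>A (x, s u) / s\<close>.  At \<open>t = 0\<close> it degenerates to the projection onto the fibre directions.\<close>

definition collapsing_frame ::
    "('e::euclidean_space \<times> 'f::euclidean_space \<Rightarrow> 'e \<Rightarrow> 'f) \<Rightarrow> real \<Rightarrow> 'e \<times> 'f \<Rightarrow> 'e \<times> 'f \<Rightarrow> 'e \<times> 'f" where
  "collapsing_frame A t p X = (t *\<^sub>R fst X, snd X + t *\<^sub>R A p (fst X))"

definition fibre_scaling :: "real \<Rightarrow> 'e::euclidean_space \<times> 'f::euclidean_space \<Rightarrow> 'e \<times> 'f" where
  "fibre_scaling s p = (fst p, s *\<^sub>R snd p)"

lemma linear_fibre_scaling: "linear (fibre_scaling s)"
  by (rule linearI) (simp_all add: fibre_scaling_def algebra_simps)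

context C2_shear
begin

definition collapsing_density :: "real \<Rightarrow> 'e \<times> 'f \<Rightarrow> real" where
  "collapsing_density t p = quadratic_invariant (jet_riemann t
     (\<lambda>X. A1 p (collapsing_frame A t p X))
     (\<lambda>X Y. A2 p (collapsing_frame A t p X) (collapsing_frame A t p Y)))"

lemma linear_A1: "linear (\<lambda>X. A1 p X b)"
  using A1 has_derivative_linear by blast

lemma linear_A2: "linear (\<lambda>X. A2 p X Y b)" "linear (\<lambda>Y. A2 p X Y b)"
proof -
  show *: "linear (\<lambda>X. A2 p X Y b)" for Y
    using A2 has_derivative_linear by blast
  show "linear (\<lambda>Y. A2 p X Y b)"
    using *[of X] by (simp add: A2_commute[of p X])
qed

text \<open>Rescaling the fibre coordinate in \<open>\<phi>\<close> by \<open>s\<close> amounts to replacing \<open>A (x, u)\<close> by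
  \<open>A (x, s u) / s\<close>, because the fundamental fields are linear in the fibre coordinate.\<close>

lemma C2_shear_scaled:
  "C2_shear (\<lambda>p b. (1 / s) *\<^sub>R A (fibre_scaling s p) b)
     (\<lambda>p X b. (1 / s) *\<^sub>R A1 (fibre_scaling s p) (fibre_scaling s X) b)
     (\<lambda>p X Y b. (1 / s) *\<^sub>R A2 (fibre_scaling s p) (fibre_scaling s X) (fibre_scaling s Y) b)"
proof (rule C2_shear.intro)
  have sc: "(fibre_scaling s has_derivative fibre_scaling s) (at p)" for p :: "'e \<times> 'f"
    using linear_fibre_scaling linear_conv_bounded_linear bounded_linear_imp_has_derivative by blast
  fix p X Y :: "'e \<times> 'f" and b :: 'e
  show "linear (\<lambda>b. (1 / s) *\<^sub>R A (fibre_scaling s p) b)"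
    by (rule linear_compose_scale_right[OF linear_A])
  show "((\<lambda>q. (1 / s) *\<^sub>R A (fibre_scaling s q) b) has_derivative
      (\<lambda>X. (1 / s) *\<^sub>R A1 (fibre_scaling s p) (fibre_scaling s X) b)) (at p)"
    by (intro has_derivative_scaleR_right has_derivative_compose[OF sc A1])
  show "((\<lambda>q. (1 / s) *\<^sub>R A1 (fibre_scaling s q) (fibre_scaling s Y) b) has_derivative
      (\<lambda>X. (1 / s) *\<^sub>R A2 (fibre_scaling s p) (fibre_scaling s X) (fibre_scaling s Y) b)) (at p)"
    by (intro has_derivative_scaleR_right has_derivative_compose[OF sc A2])
  show "(1 / s) *\<^sub>R A2 (fibre_scaling s p) (fibre_scaling s X) (fibre_scaling s Y) b
      = (1 / s) *\<^sub>R A2 (fibre_scaling s p) (fibre_scaling s Y) (fibre_scaling s X) b"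
    by (simp add: A2_commute)
  show "continuous_on UNIV (\<lambda>p. (1 / s) *\<^sub>R A2 (fibre_scaling s p) (fibre_scaling s X) (fibre_scaling s Y) b)"
    using linear_continuous_on[OF linear_fibre_scaling[unfolded linear_conv_bounded_linear]]
    by (intro continuous_on_scaleR continuous_on_const
        continuous_on_compose2[OF continuous_A2, of UNIV "fibre_scaling s"]) auto
qed

text \<open>The derivatives of \<open>A (x, s u) / s\<close> along its frame are those of \<open>A\<close> along the collapsing
  frame; the second derivative retains one factor \<open>s\<close>, which the parameter of \<open>jet_riemann\<close> absorbs.
  So up to the factor \<open>s\<^sup>2\<close> the integrand extends to \<open>1 / s = 0\<close>.\<close>

lemma a2_density_scaled:
  assumes "s > 0"
  defines "B \<equiv> \<lambda>p b. (1 / s) *\<^sub>R A (fibre_scaling s p) b"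
  shows "(1 / s)\<^sup>2 * a2_density (shear_metric B) p = collapsing_density (1 / s) (fibre_scaling s p)"
proof -
  interpret scaled: C2_shear B "\<lambda>p X b. (1 / s) *\<^sub>R A1 (fibre_scaling s p) (fibre_scaling s X) b"
     "\<lambda>p X Y b. (1 / s) *\<^sub>R A2 (fibre_scaling s p) (fibre_scaling s X) (fibre_scaling s Y) b"
    unfolding B_def by (rule C2_shear_scaled)
  define q where "q = fibre_scaling s p"
  define \<tau> where "\<tau> = collapsing_frame A (1 / s) q"
  have \<tau>: "(1 / s) *\<^sub>R fibre_scaling s (shear_frame B p X) = \<tau> X" for X
    using \<open>s > 0\<close>
    by (simp add: \<tau>_def q_def B_def fibre_scaling_def shear_frame_def collapsing_frame_def
        algebra_simps)
  have "(1 / s) *\<^sub>R A1 q (fibre_scaling s (shear_frame B p X)) b = A1 q (\<tau> X) b" for X b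
    by (simp add: linear_cmul[OF linear_A1] flip: \<tau>)
  moreover have "(1 / s) *\<^sub>R A2 q (fibre_scaling s (shear_frame B p X)) (fibre_scaling s (shear_frame B p Y)) b
      = (1 / (1 / s)) *\<^sub>R A2 q (\<tau> X) (\<tau> Y) b" for X Y b
    using \<open>s > 0\<close> by (simp add: linear_cmul[OF linear_A2(1)] linear_cmul[OF linear_A2(2)] flip: \<tau>)
  ultimately have "a2_density (shear_metric B) p = quadratic_invariant (jet_riemann 1
      (\<lambda>X. A1 q (\<tau> X)) (\<lambda>X Y b. (1 / (1 / s)) *\<^sub>R A2 q (\<tau> X) (\<tau> Y) b))"
    unfolding scaled.a2_density_shear q_def[symmetric] by (simp only:)
  then have "(1 / s)\<^sup>2 * a2_density (shear_metric B) p = quadratic_invariant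
     (\<lambda>a b c d. (1 / s) * jet_riemann 1 (\<lambda>X. A1 q (\<tau> X)) (\<lambda>X Y b. (1 / (1 / s)) *\<^sub>R A2 q (\<tau> X) (\<tau> Y) b) a b c d)"
    by (simp only: quadratic_invariant_scale)
  also have "\<dots> = collapsing_density (1 / s) q"
    using \<open>s > 0\<close> by (subst jet_riemann_scale) (auto simp: collapsing_density_def \<tau>_def)
  finally show ?thesis by (simp add: q_def)
qed

end

section \<open>Polynomial dependence on a parameter\<close>

text \<open>Polynomials in \<open>t\<close> with continuous coefficients, generated as in the Horner scheme.  The inductive
  form makes closure under products a double induction, without any convolution of coefficients.\<close>

inductive polynomial_family :: "(real \<Rightarrow> 'p::topological_space \<Rightarrow> 'v::real_normed_vector) \<Rightarrow> bool" where
  const: "continuous_on UNIV c \<Longrightarrow> polynomial_family (\<lambda>t p. c p)"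
| step: "continuous_on UNIV c \<Longrightarrow> polynomial_family F \<Longrightarrow> polynomial_family (\<lambda>t p. c p + t *\<^sub>R F t p)"

lemma polynomial_family_continuous: "polynomial_family F \<Longrightarrow> continuous_on UNIV (F t)"
  by (induction rule: polynomial_family.induct) (auto intro!: continuous_intros)

lemma polynomial_family_shift:
  assumes "polynomial_family F"
  shows "polynomial_family (\<lambda>t p. t *\<^sub>R F t p)"
  using polynomial_family.step[OF continuous_on_const[of UNIV 0] assms] by simp

lemma polynomial_family_add_const:
  assumes "continuous_on UNIV c" "polynomial_family F"
  shows "polynomial_family (\<lambda>t p. c p + F t p)"
  using assms(2)
proof (cases rule: polynomial_family.cases)
  case (const c')
  have "polynomial_family (\<lambda>(t::real) p. c p + c' p)"
    by (rule polynomial_family.const) (rule continuous_on_add[OF assms(1) const(2)])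
  then show ?thesis by (simp only: const(1))
next
  case (step c' F')
  have "polynomial_family (\<lambda>t p. (c p + c' p) + t *\<^sub>R F' t p)"
    by (rule polynomial_family.step[OF continuous_on_add[OF assms(1) step(2)] step(3)])
  then show ?thesis by (simp only: step(1) add.assoc)
qed

lemma polynomial_family_add:
  assumes "polynomial_family F" "polynomial_family G"
  shows "polynomial_family (\<lambda>t p. F t p + G t p)"
  using assms
proof (induction arbitrary: G rule: polynomial_family.induct)
  case (const c)
  then show ?case by (rule polynomial_family_add_const)
next
  case (step c F)
  from step.prems show ?case
  proof (cases rule: polynomial_family.cases)
    case (const c')
    have "polynomial_family (\<lambda>t p. c' p + (c p + t *\<^sub>R F t p))"
      by (rule polynomial_family_add_const[OF const(2) polynomial_family.step[OF step.hyps]])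
    then show ?thesis by (simp only: const(1) add.commute)
  next
    case (step c' F')
    have "polynomial_family (\<lambda>t p. (c p + c' p) + t *\<^sub>R (F t p + F' t p))"
      by (rule polynomial_family.step[OF continuous_on_add[OF \<open>continuous_on UNIV c\<close> step(2)]
            step.IH[OF step(3)]])
    then show ?thesis
      unfolding step(1) by (simp only: scaleR_add_right add.assoc add.left_commute)
  qed
qed

lemma polynomial_family_bilinear:
  assumes h: "bounded_bilinear h" and "polynomial_family F" "polynomial_family G"
  shows "polynomial_family (\<lambda>t p. h (F t p) (G t p))"
  using assms(2,3)
proof (induction rule: polynomial_family.induct)
  case (const c)
  from const(2,1) show ?case
  proof (induction rule: polynomial_family.induct)
    case (const c')
    then show ?case by (intro polynomial_family.const bounded_bilinear.continuous_on[OF h])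
  next
    case (step c' F')
    then have "polynomial_family (\<lambda>t p. (h (c p) (c' p)) + t *\<^sub>R (h (c p) (F' t p)))"
      by (intro polynomial_family.step bounded_bilinear.continuous_on[OF h]) auto
    then show ?case by (simp add: bounded_bilinear.add_right[OF h] bounded_bilinear.scaleR_right[OF h])
  qed
next
  case (step c F)
  have "polynomial_family (\<lambda>t p. h (c p) (G t p))"
    using step(4)
  proof (induction rule: polynomial_family.induct)
    case (const c')
    then show ?case by (intro polynomial_family.const bounded_bilinear.continuous_on[OF h] step)
  next
    case (step c' F')
    then have "polynomial_family (\<lambda>t p. (h (c p) (c' p)) + t *\<^sub>R (h (c p) (F' t p)))"
      using \<open>continuous_on UNIV c\<close> by (intro polynomial_family.step bounded_bilinear.continuous_on[OF h]) auto
    then show ?case by (simp add: bounded_bilinear.add_right[OF h] bounded_bilinear.scaleR_right[OF h])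
  qed
  moreover have "polynomial_family (\<lambda>t p. t *\<^sub>R (h (F t p) (G t p)))"
    using step by (intro polynomial_family_shift) auto
  ultimately have "polynomial_family (\<lambda>t p. h (c p) (G t p) + t *\<^sub>R (h (F t p) (G t p)))"
    by (rule polynomial_family_add)
  then show ?case by (simp add: bounded_bilinear.add_left[OF h] bounded_bilinear.scaleR_left[OF h])
qed

lemma polynomial_family_parameter: "polynomial_family (\<lambda>t p. t)"
  using polynomial_family_shift[OF polynomial_family.const[OF continuous_on_const[of UNIV "1::real"]]]
  by simp

lemma polynomial_family_sum:
  "(\<And>i. i \<in> I \<Longrightarrow> polynomial_family (F i)) \<Longrightarrow> polynomial_family (\<lambda>t p. \<Sum>i\<in>I. F i t p)"
  by (induction I rule: infinite_finite_induct)
    (auto intro: polynomial_family.const polynomial_family_add)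

lemmas polynomial_family_inner = polynomial_family_bilinear[OF bounded_bilinear_inner]
lemmas polynomial_family_mult = polynomial_family_bilinear[OF bounded_bilinear_mult]
lemmas polynomial_family_scaleR = polynomial_family_bilinear[OF bounded_bilinear_scaleR]

lemma polynomial_family_uminus:
  assumes "polynomial_family F"
  shows "polynomial_family (\<lambda>t p. - F t p)"
  using polynomial_family_scaleR[OF polynomial_family.const[OF continuous_on_const[of UNIV "-1::real"]] assms]
  by simp

lemma polynomial_family_diff:
  "polynomial_family F \<Longrightarrow> polynomial_family G \<Longrightarrow> polynomial_family (\<lambda>t p. F t p - G t p)"
  using polynomial_family_add[OF _ polynomial_family_uminus, of F G] by simp

lemma polynomial_family_power2:
  "polynomial_family F \<Longrightarrow> polynomial_family (\<lambda>t p. (F t p :: real)\<^sup>2)"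
  by (simp add: power2_eq_square polynomial_family_mult)

lemma polynomial_family_divide:
  assumes "polynomial_family F"
  shows "polynomial_family (\<lambda>t p. (F t p :: real) / r)"
  using polynomial_family_mult[OF assms polynomial_family.const[OF continuous_on_const[of UNIV "1 / r"]]]
  by simp

lemmas polynomial_family_intros =
  polynomial_family_add polynomial_family_diff polynomial_family_uminus polynomial_family_sum
  polynomial_family_mult polynomial_family_power2 polynomial_family_divide
  polynomial_family_inner polynomial_family_scaleR polynomial_family_parameter

text \<open>Used for the derivatives of \<open>A\<close> along the collapsing frame, which is itself a polynomial in \<open>t\<close>.\<close>

lemma polynomial_family_linear:
  fixes L :: "real \<Rightarrow> 'p::topological_space \<Rightarrow> 'a::euclidean_space \<Rightarrow> 'v::real_normed_vector"
  assumes "\<And>t p. linear (L t p)" "\<And>i. polynomial_family (\<lambda>t p. L t p i)" "polynomial_family w"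
  shows "polynomial_family (\<lambda>t p. L t p (w t p))"
proof -
  have expand: "L t p v = (\<Sum>i\<in>Basis. (v \<bullet> i) *\<^sub>R L t p i)" for t p v
    by (subst euclidean_representation[of v, symmetric])
      (simp only: linear_sum[OF assms(1)] linear_cmul[OF assms(1)])
  have "(\<lambda>t p. L t p (w t p)) = (\<lambda>t p. \<Sum>i\<in>Basis. (w t p \<bullet> i) *\<^sub>R L t p i)"
    by (intro ext) (rule expand)
  then show ?thesis
    by (simp only:) (intro polynomial_family_intros assms polynomial_family.const continuous_on_const)
qed

lemma integral_polynomial_family:
  fixes F :: "real \<Rightarrow> 'p::euclidean_space \<Rightarrow> real"
  assumes "polynomial_family F" "compact K" "\<And>t p. p \<notin> K \<Longrightarrow> F t p = 0"
  obtains P where "\<And>t. (\<integral>p. F t p \<partial>lborel) = poly P t"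
proof -
  have int: "integrable lborel (\<lambda>p. indicator K p *\<^sub>R c p)" if "continuous_on UNIV c" for c :: "'p \<Rightarrow> real"
    using borel_integrable_compact[OF \<open>compact K\<close>, of c] that
    by (simp add: continuous_on_subset)
  from assms(1) have "\<exists>P. \<forall>t. (\<integral>p. indicator K p *\<^sub>R F t p \<partial>lborel) = poly P t"
  proof (induction rule: polynomial_family.induct)
    case (const c)
    show ?case by (rule exI[of _ "[:\<integral>p. indicator K p *\<^sub>R c p \<partial>lborel:]"]) simp
  next
    case (step c F)
    then obtain P where P: "\<And>t. (\<integral>p. indicator K p *\<^sub>R F t p \<partial>lborel) = poly P t" by blast
    have "(\<integral>p. indicator K p *\<^sub>R (c p + t *\<^sub>R F t p) \<partial>lborel)
        = (\<integral>p. indicator K p *\<^sub>R c p \<partial>lborel) + t * poly P t" for t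
    proof -
      have "(\<integral>p. indicator K p *\<^sub>R (c p + t *\<^sub>R F t p) \<partial>lborel)
          = (\<integral>p. indicator K p *\<^sub>R c p + t * (indicator K p *\<^sub>R F t p) \<partial>lborel)"
        by (simp add: algebra_simps)
      also have "\<dots> = (\<integral>p. indicator K p *\<^sub>R c p \<partial>lborel) + t * (\<integral>p. indicator K p *\<^sub>R F t p \<partial>lborel)"
        using int[OF step(1)] int[OF polynomial_family_continuous[OF step(2)], of t]
        by (subst Bochner_Integration.integral_add) auto
      finally show ?thesis by (simp only: P)
    qed
    then show ?case
      by (intro exI[of _ "pCons (\<integral>p. indicator K p *\<^sub>R c p \<partial>lborel) P"]) simp
  qed
  moreover have "indicator K p *\<^sub>R F t p = F t p" for t p
    using assms(3) by (auto simp: indicator_def)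
  ultimately show ?thesis using that by (auto simp only:)
qed

section \<open>The second heat invariant of a collapsing family\<close>

text \<open>For \<open>H\<close> the second derivative of a vector field \<open>X\<close> on the fibre, \<open>codazzi H\<close> is
  \<open>(\<partial>\<^sub>c \<partial>\<^sub>a X\<^sub>b - \<partial>\<^sub>c \<partial>\<^sub>b X\<^sub>a) / 2\<close>, which is also the exterior derivative of the symmetrised
  derivative of \<open>X\<close>.  It is the part of the curvature with one horizontal and three vertical
  arguments, as in the Codazzi equation for the fibres.\<close>

definition codazzi :: "('f::euclidean_space \<Rightarrow> 'f \<Rightarrow> 'f) \<Rightarrow> 'f \<Rightarrow> 'f \<Rightarrow> 'f \<Rightarrow> real" where
  "codazzi H a b c = (H a c \<bullet> b - H b c \<bullet> a) / 2"

definition codazzi_energy :: "('f::euclidean_space \<Rightarrow> 'f \<Rightarrow> 'f) \<Rightarrow> real" where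
  "codazzi_energy H = 2 * (\<Sum>a\<in>Basis. \<Sum>b\<in>Basis. \<Sum>c\<in>Basis. (codazzi H a b c)\<^sup>2)
     - (\<Sum>b\<in>Basis. (\<Sum>a\<in>Basis. codazzi H a b a)\<^sup>2)"

lemma sum_Basis_pair:
  "(\<Sum>b\<in>(Basis :: ('a::euclidean_space \<times> 'b::euclidean_space) set). f b)
     = (\<Sum>i\<in>Basis. f (i, 0)) + (\<Sum>j\<in>Basis. f (0, j))"
proof -
  have "inj_on (\<lambda>u. (u::'a, 0::'b)) Basis" "inj_on (\<lambda>u. (0::'a, u::'b)) Basis"
    by (auto intro!: inj_onI)
  then show ?thesis
    unfolding Basis_prod_def by (subst sum.union_disjoint) (auto simp: sum.reindex)
qed

text \<open>At \<open>t = 0\<close> only components with exactly one horizontal argument survive.  There are four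
  positions for it, each contributing the same amount to the norm of the curvature; the Ricci
  tensor has two positions, and the scalar curvature none.  Hence the weights \<open>2 * 4\<close> and
  \<open>2 * 2\<close>, whose common factor is the \<open>4\<close> of the conclusion.\<close>

lemma quadratic_invariant_collapsed:
  fixes H :: "'f::euclidean_space \<Rightarrow> 'f \<Rightarrow> 'e::euclidean_space \<Rightarrow> 'f"
  assumes sym: "\<And>a b i. H a b i = H b a i"
    and zero [simp]: "\<And>b i. H 0 b i = 0" "\<And>a b. H a b 0 = 0"
  shows "quadratic_invariant (jet_riemann 0 \<alpha> (\<lambda>X Y. H (snd X) (snd Y)))
       = 4 * (\<Sum>i\<in>Basis. codazzi_energy (\<lambda>a b. H a b i))"
proof -
  let ?E = "Basis :: 'e set" and ?F = "Basis :: 'f set"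
  define R where "R = jet_riemann 0 \<alpha> (\<lambda>X Y. H (snd X) (snd Y))"
  define C where "C i = codazzi (\<lambda>a b. H a b i)" for i
  have [simp]: "H a 0 i = 0" for a i
    using sym[of a 0] by simp
  have R_eq: "R X Y Z W = (jet2 0 \<alpha> (\<lambda>X Y. H (snd X) (snd Y)) X Z Y W
      - jet2 0 \<alpha> (\<lambda>X Y. H (snd X) (snd Y)) X W Y Z - jet2 0 \<alpha> (\<lambda>X Y. H (snd X) (snd Y)) Y Z X W
      + jet2 0 \<alpha> (\<lambda>X Y. H (snd X) (snd Y)) Y W X Z) / 2" for X Y Z W
    by (simp add: R_def jet_riemann_def)
  have R: "R (0, a) (0, b) (0, c) (i, 0) = - C i a b c"
    "R (0, a) (0, b) (i, 0) (0, c) = C i a b c"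
    "R (0, a) (i, 0) (0, b) (0, c) = - C i b c a"
    "R (i, 0) (0, a) (0, b) (0, c) = C i b c a" for a b c i
    unfolding R_eq jet2_def C_def codazzi_def
    by (simp_all add: sym[of b a i] sym[of c a i] inner_commute) (simp_all add: field_simps)
  have R0: "R (0, a) (0, b) (0, c) (0, d) = 0"
    "R (i, 0) (j, 0) Z W = 0" "R X Y (i, 0) (j, 0) = 0"
    "R (i, 0) (0, b) (j, 0) (0, d) = 0" "R (i, 0) (0, b) (0, c) (j, 0) = 0"
    "R (0, a) (i, 0) (0, c) (j, 0) = 0" "R (0, a) (i, 0) (j, 0) (0, d) = 0"
    for a b c d i j X Y Z W
    unfolding R_eq jet2_def by simp_all
  have swap3: "(\<Sum>a\<in>?F. \<Sum>b\<in>?F. \<Sum>c\<in>?F. f a b c) = (\<Sum>b\<in>?F. \<Sum>c\<in>?F. \<Sum>a\<in>?F. f a b c)"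
    for f :: "'f \<Rightarrow> 'f \<Rightarrow> 'f \<Rightarrow> real"
    by (subst sum.swap) (intro sum.cong refl sum.swap)
  define N where "N = (\<Sum>i\<in>?E. \<Sum>a\<in>?F. \<Sum>b\<in>?F. \<Sum>c\<in>?F. (C i a b c)\<^sup>2)"
  \<comment> \<open>The four sums that arise from the positions of the horizontal argument differ only in the
    order of summation and the names of the indices.\<close>
  have N1: "(\<Sum>a\<in>?F. \<Sum>b\<in>?F. \<Sum>c\<in>?F. \<Sum>i\<in>?E. (C i a b c)\<^sup>2) = N"
  proof -
    have "(\<Sum>a\<in>?F. \<Sum>b\<in>?F. \<Sum>c\<in>?F. \<Sum>i\<in>?E. (C i a b c)\<^sup>2)
        = (\<Sum>a\<in>?F. \<Sum>b\<in>?F. \<Sum>i\<in>?E. \<Sum>c\<in>?F. (C i a b c)\<^sup>2)"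
      by (intro sum.cong[OF refl]) (rule sum.swap)
    also have "\<dots> = (\<Sum>a\<in>?F. \<Sum>i\<in>?E. \<Sum>b\<in>?F. \<Sum>c\<in>?F. (C i a b c)\<^sup>2)"
      by (rule sum.cong[OF refl]) (rule sum.swap)
    also have "\<dots> = N"
      unfolding N_def by (rule sum.swap)
    finally show ?thesis .
  qed
  have N2: "(\<Sum>a\<in>?F. \<Sum>b\<in>?F. \<Sum>i\<in>?E. \<Sum>c\<in>?F. (C i a b c)\<^sup>2) = N"
    unfolding N1[symmetric] by (intro sum.cong[OF refl]) (rule sum.swap)
  have N3: "(\<Sum>a\<in>?F. \<Sum>i\<in>?E. \<Sum>b\<in>?F. \<Sum>c\<in>?F. (C i b c a)\<^sup>2) = N"
  proof -
    have "(\<Sum>a\<in>?F. \<Sum>i\<in>?E. \<Sum>b\<in>?F. \<Sum>c\<in>?F. (C i b c a)\<^sup>2)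
        = (\<Sum>i\<in>?E. \<Sum>a\<in>?F. \<Sum>b\<in>?F. \<Sum>c\<in>?F. (C i b c a)\<^sup>2)"
      by (rule sum.swap)
    then show ?thesis
      unfolding N_def by (simp only: swap3[of "\<lambda>a b c. (C _ b c a)\<^sup>2"])
  qed
  have N4: "(\<Sum>i\<in>?E. \<Sum>a\<in>?F. \<Sum>b\<in>?F. \<Sum>c\<in>?F. (C i b c a)\<^sup>2) = N"
    unfolding N_def by (simp only: swap3[of "\<lambda>a b c. (C _ b c a)\<^sup>2"])
  have full: "(\<Sum>a\<in>Basis. \<Sum>b\<in>Basis. \<Sum>c\<in>Basis. \<Sum>d\<in>Basis. (R a b c d)\<^sup>2) = 4 * N"
    using N1 N2 N3 N4 by (simp add: sum_Basis_pair R R0 sum.distrib)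
  define V where "V i b = (\<Sum>a\<in>?F. C i a b a)" for i b
  have "- C i b a a = C i a b a" for i a b
    by (simp add: C_def codazzi_def field_simps)
  then have V': "(\<Sum>a\<in>?F. - C i b a a) = V i b" for i b
    by (simp only: V_def)
  have ric: "(\<Sum>a\<in>Basis. \<Sum>b\<in>Basis. (\<Sum>c\<in>Basis. R c a b c)\<^sup>2) = 2 * (\<Sum>i\<in>?E. \<Sum>b\<in>?F. (V i b)\<^sup>2)"
    by (simp add: sum_Basis_pair R R0 sum.distrib V' flip: V_def)
      (subst sum.swap, simp)
  have scal: "(\<Sum>a\<in>Basis. \<Sum>c\<in>Basis. R c a a c) = 0"
    by (simp add: sum_Basis_pair R R0)
  show ?thesis
    unfolding R_def[symmetric] quadratic_invariant_def full ric scal codazzi_energy_def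
      C_def[symmetric] V_def[symmetric] N_def
    by (simp add: sum_subtractf flip: sum_distrib_left)
qed

lemma derivative_vanishes_off_closed:
  assumes "(f has_derivative h) (at q)" "closed K" "\<And>p. p \<notin> K \<Longrightarrow> f p = 0" "q \<notin> K"
  shows "h = (\<lambda>_. 0)"
proof -
  have "(f has_derivative (\<lambda>_. 0)) (at q)"
    using has_derivative_transform_within_open[OF has_derivative_const[of 0 "at q"], of "- K" f]
      assms(2-4) by auto
  with assms(1) show ?thesis by (rule has_derivative_unique)
qed

context C2_shear
begin

lemma A_zero: "A p 0 = 0"
  by (rule linear_0[OF linear_A])

lemma A1_zero: "A1 p X 0 = 0"
proof -
  have "((\<lambda>q. A q 0) has_derivative (\<lambda>_. 0)) (at p)" by (simp add: A_zero)
  from has_derivative_unique[OF A1 this] show ?thesis by (rule fun_cong)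
qed

lemma A2_zero: "A2 p X Y 0 = 0"
proof -
  have "((\<lambda>q. A1 q Y 0) has_derivative (\<lambda>_. 0)) (at p)" by (simp add: A1_zero)
  from has_derivative_unique[OF A2 this] show ?thesis by (rule fun_cong)
qed

lemma collapsing_density_0:
  "collapsing_density 0 p = 4 * (\<Sum>i\<in>Basis. codazzi_energy (\<lambda>a b. A2 p (0, a) (0, b) i))"
proof -
  have "A2 p (0, 0) Y b = 0" for Y b
    using linear_0[OF linear_A2(1), of p Y b] by (simp add: zero_prod_def)
  then show ?thesis
    unfolding collapsing_density_def collapsing_frame_def
    using quadratic_invariant_collapsed[of "\<lambda>a b. A2 p (0, a) (0, b)"]
    by (simp add: A2_commute A2_zero)
qed

lemma continuous_A: "continuous_on UNIV (\<lambda>p. A p b)"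
  by (intro continuous_at_imp_continuous_on ballI has_derivative_continuous[OF A1])

lemma continuous_A1: "continuous_on UNIV (\<lambda>p. A1 p X b)"
  by (intro continuous_at_imp_continuous_on ballI has_derivative_continuous[OF A2])

lemma polynomial_family_collapsing_density: "polynomial_family collapsing_density"
proof -
  have w: "polynomial_family (\<lambda>t p. collapsing_frame A t p X)" for X
  proof -
    have "polynomial_family (\<lambda>t p. (0, snd X) + t *\<^sub>R (fst X, A p (fst X)))"
      by (intro polynomial_family.step polynomial_family.const continuous_on_const
          continuous_on_Pair continuous_A)
    then show ?thesis
      by (simp add: collapsing_frame_def)
  qed
  define \<alpha> where "\<alpha> t p X = A1 p (collapsing_frame A t p X)" for t p X
  define \<beta> where "\<beta> t p X Y = A2 p (collapsing_frame A t p X) (collapsing_frame A t p Y)" for t p X Y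
  have c: "polynomial_family (\<lambda>(t::real) (p::'e \<times> 'f). c)" for c :: "'v::real_normed_vector"
    by (intro polynomial_family.const continuous_on_const)
  have \<alpha>: "polynomial_family (\<lambda>t p. \<alpha> t p X b)" for X b
    unfolding \<alpha>_def
    by (rule polynomial_family_linear[where L = "\<lambda>t p X. A1 p X b", OF linear_A1 _ w])
      (rule polynomial_family.const[OF continuous_A1])
  have "polynomial_family (\<lambda>t p. A2 p V (collapsing_frame A t p X) b)" for V X b
    by (rule polynomial_family_linear[where L = "\<lambda>t p X. A2 p V X b", OF linear_A2(2) _ w])
      (rule polynomial_family.const[OF continuous_A2])
  then have \<beta>: "polynomial_family (\<lambda>t p. \<beta> t p X Y b)" for X Y b
    unfolding \<beta>_def
    by (rule polynomial_family_linear[where L = "\<lambda>t p X. A2 p X (collapsing_frame A t p Y) b",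
          OF linear_A2(1) _ w])
  have j1: "polynomial_family (\<lambda>t p. jet1 (\<alpha> t p) X V W)" for X V W
    unfolding jet1_def
    by (intro polynomial_family_diff polynomial_family_uminus polynomial_family_inner \<alpha> c)
  have j2: "polynomial_family (\<lambda>t p. jet2 t (\<alpha> t p) (\<beta> t p) X Y V W)" for X Y V W
    unfolding jet2_def
    by (intro polynomial_family_diff polynomial_family_uminus polynomial_family_inner
        polynomial_family_add polynomial_family_mult polynomial_family_parameter \<alpha> \<beta> c)
  have low: "polynomial_family (\<lambda>t p. jet_lowered (\<alpha> t p) X Y Z)" for X Y Z
    unfolding jet_lowered_def
    by (intro polynomial_family_divide polynomial_family_diff polynomial_family_add j1)
  have R: "polynomial_family (\<lambda>t p. jet_riemann t (\<alpha> t p) (\<beta> t p) X Y Z W)" for X Y Z W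
    unfolding jet_riemann_def
    by (intro polynomial_family_divide polynomial_family_diff polynomial_family_add
        polynomial_family_mult polynomial_family_sum polynomial_family_parameter j2 low)
  have "polynomial_family (\<lambda>t p. quadratic_invariant (jet_riemann t (\<alpha> t p) (\<beta> t p)))"
    unfolding quadratic_invariant_def
    by (intro polynomial_family_add polynomial_family_diff polynomial_family_mult
        polynomial_family_sum polynomial_family_power2 R c)
  then show ?thesis
    by (simp add: collapsing_density_def[abs_def] \<alpha>_def[abs_def] \<beta>_def[abs_def])
qed

lemma derivatives_vanish:
  assumes "closed K" "\<And>p b. p \<notin> K \<Longrightarrow> A p b = 0" "p \<notin> K"
  shows "A1 p X b = 0" "A2 p X Y b = 0"
proof -
  have A1_0: "A1 q X b = 0" if "q \<notin> K" for q X b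
    using derivative_vanishes_off_closed[OF A1 assms(1,2) that] by (rule fun_cong)
  then show "A1 p X b = 0" using assms(3) by blast
  show "A2 p X Y b = 0"
    using derivative_vanishes_off_closed[OF A2 assms(1) A1_0 assms(3)] by (rule fun_cong)
qed

lemma collapsing_density_vanishes:
  assumes "closed K" "\<And>p b. p \<notin> K \<Longrightarrow> A p b = 0" "p \<notin> K"
  shows "collapsing_density t p = 0"
  unfolding collapsing_density_def quadratic_invariant_def jet_riemann_def
    jet_lowered_def jet2_def jet1_def
  by (simp add: derivatives_vanish[OF assms])

end

lemma integral_fibre_scaling:
  fixes h :: "'e::euclidean_space \<times> 'f::euclidean_space \<Rightarrow> real"
  assumes "h \<in> borel_measurable borel" "s > 0"
  shows "\<exists>c>0. (\<integral>p. h (fibre_scaling s p) \<partial>lborel) = c * (\<integral>p. h p \<partial>lborel)"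
proof -
  define c :: "'e \<times> 'f \<Rightarrow> real" where "c j = (if snd j = 0 then 1 else s)" for j
  have c: "c j \<noteq> 0" for j using assms(2) by (simp add: c_def)
  let ?d = "\<Prod>j\<in>Basis. \<bar>c j\<bar>"
  have d: "?d > 0" using c by (intro prod_pos) auto
  have T: "0 + (\<Sum>j\<in>Basis. (c j * (p \<bullet> j)) *\<^sub>R j) = fibre_scaling s p" for p
  proof -
    have "(\<Sum>i\<in>Basis. (fst p \<bullet> i) *\<^sub>R (i, 0 :: 'f)) = (fst p, 0)"
      by (simp add: prod_eq_iff fst_sum snd_sum euclidean_representation)
    moreover have "(\<Sum>i\<in>Basis. (s * (snd p \<bullet> i)) *\<^sub>R (0 :: 'e, i)) = (0, s *\<^sub>R snd p)"
      by (simp add: prod_eq_iff fst_sum snd_sum euclidean_representation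
          flip: scaleR_scaleR scaleR_sum_right)
    moreover have "(i::'f) \<in> Basis \<Longrightarrow> i \<noteq> 0" for i by auto
    ultimately show ?thesis
      by (cases p) (simp add: sum_Basis_pair c_def fibre_scaling_def cong: sum.cong)
  qed
  have [measurable]: "fibre_scaling s \<in> borel_measurable (borel :: ('e \<times> 'f) measure)"
    using linear_continuous_on[OF linear_fibre_scaling[unfolded linear_conv_bounded_linear]]
    by (rule borel_measurable_continuous_onI)
  have meas [measurable]: "h \<in> borel_measurable borel" by fact
  have "(\<integral>p. h p \<partial>lborel) = (\<integral>p. h p \<partial>density (distr lborel borel (fibre_scaling s)) (\<lambda>_. ?d))"
    using lborel_affine_euclidean[of c 0, OF c] by (simp only: T)
  also have "\<dots> = ?d * (\<integral>p. h (fibre_scaling s p) \<partial>lborel)"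
    using d by (subst integral_density) (auto simp: integral_distr intro: less_imp_le)
  finally show ?thesis
    using d by (intro exI[of _ "1 / ?d"] conjI) (simp_all only: zero_less_divide_1_iff, simp add: c)
qed

lemma a2_eq_integral_density:
  assumes "\<And>p. metric_det g p = 1"
  shows "a2 (g :: 'a::euclidean_space metric)
    = (4 * pi) powr (- real DIM('a) / 2) / 360 * (\<integral>p. a2_density g p \<partial>lborel)"
  by (simp add: a2_def a2_density_def assms)

text \<open>As a function of \<open>1 / s\<close>, the heat invariant is a nowhere vanishing factor times a polynomial
  whose constant term is the integral at \<open>t = 0\<close>.  The index type \<open>'n\<close> serves to identify the
  metric determinant with a matrix determinant.\<close>

theorem (in C2_shear) finite_zeros_a2:
  assumes "CARD('n::finite) = DIM('e \<times> 'f)"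
    and K: "compact K" "\<And>p b. p \<notin> K \<Longrightarrow> A p b = 0"
    and "(\<integral>p. collapsing_density 0 p \<partial>lborel) \<noteq> 0"
  shows "finite {s. s > 0 \<and> a2 (shear_metric (\<lambda>p b. (1 / s) *\<^sub>R A (fibre_scaling s p) b)) = 0}"
    (is "finite ?Z")
proof -
  obtain P where P: "\<And>t. (\<integral>p. collapsing_density t p \<partial>lborel) = poly P t"
    using integral_polynomial_family[OF polynomial_family_collapsing_density K(1)]
      collapsing_density_vanishes[OF compact_imp_closed[OF K(1)] K(2)] by metis
  have "poly P (1 / s) = 0" if "s \<in> ?Z" for s
  proof -
    let ?g = "shear_metric (\<lambda>p b. (1 / s) *\<^sub>R A (fibre_scaling s p) b)"
    from that have "s > 0" and a2: "a2 ?g = 0" by auto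
    interpret scaled: C2_shear "\<lambda>p b. (1 / s) *\<^sub>R A (fibre_scaling s p) b"
      "\<lambda>p X b. (1 / s) *\<^sub>R A1 (fibre_scaling s p) (fibre_scaling s X) b"
      "\<lambda>p X Y b. (1 / s) *\<^sub>R A2 (fibre_scaling s p) (fibre_scaling s X) (fibre_scaling s Y) b"
      by (rule C2_shear_scaled)
    have "metric_det ?g p = 1" for p
      by (rule metric_det_shear[OF scaled.linear_A assms(1)])
    with a2 have "(\<integral>p. a2_density ?g p \<partial>lborel) = 0"
      by (simp add: a2_eq_integral_density)
    then have "0 = (\<integral>p. (1 / s)\<^sup>2 * a2_density ?g p \<partial>lborel)"
      by simp
    also have "\<dots> = (\<integral>p. collapsing_density (1 / s) (fibre_scaling s p) \<partial>lborel)"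
      by (simp only: a2_density_scaled[OF \<open>s > 0\<close>])
    finally have "(\<integral>p. collapsing_density (1 / s) (fibre_scaling s p) \<partial>lborel) = 0" by simp
    moreover have "collapsing_density (1 / s) \<in> borel_measurable borel"
      using polynomial_family_continuous[OF polynomial_family_collapsing_density]
      by (rule borel_measurable_continuous_onI)
    ultimately show ?thesis
      using integral_fibre_scaling[of "collapsing_density (1 / s)" s] \<open>s > 0\<close> P[of "1 / s"] by auto
  qed
  then have "(\<lambda>s. 1 / s) ` ?Z \<subseteq> {t. poly P t = 0}" by auto
  moreover have "P \<noteq> 0" using assms(4) P[of 0] by auto
  ultimately have "finite ((\<lambda>s. 1 / s) ` ?Z)"
    using poly_roots_finite finite_subset by blast
  then show ?thesis
    by (rule finite_imageD) (auto intro: inj_onI)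
qed

section \<open>The energy of a rotational field\<close>

lemma parseval: "(\<Sum>b\<in>Basis. (x \<bullet> b) * (y \<bullet> b)) = x \<bullet> (y :: 'a::euclidean_space)"
  by (rule euclidean_inner[symmetric])

text \<open>Here \<open>H\<close> is the Hessian of \<open>\<psi> J\<close> for a skew \<open>J\<close> and a function \<open>\<psi>\<close> of \<open>|v|\<^sup>2\<close> with first
  derivative \<open>f\<close> and second derivative \<open>k\<close>.  The numbers \<open>codazzi H a b c\<close> are the coordinates
  of a vector \<open>K a b\<close>, whose norm expands into monomials in \<open>v\<close>, \<open>J v\<close> and \<open>J\<close> that Parseval's
  identity sums up.\<close>

lemma codazzi_energy_rotation:
  fixes J :: "'f::euclidean_space \<Rightarrow> 'f" and f k :: real and v :: 'f
  assumes lin: "linear J" and skew: "\<And>x y. J x \<bullet> y = - (x \<bullet> J y)"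
  defines "H \<equiv> \<lambda>a c. (2 * f * (v \<bullet> a)) *\<^sub>R J c + (2 * f * (v \<bullet> c)) *\<^sub>R J a
      + (4 * k * (v \<bullet> a) * (v \<bullet> c) + 2 * f * (a \<bullet> c)) *\<^sub>R J v"
    and "N \<equiv> real DIM('f)"
  shows "codazzi_energy H = (J v \<bullet> J v) *
       (12 * k\<^sup>2 * (v \<bullet> v)\<^sup>2 + (56 - 4 * N) * f * k * (v \<bullet> v) + (28 - N\<^sup>2) * f\<^sup>2)
     + 12 * f\<^sup>2 * (v \<bullet> v) * (\<Sum>b\<in>Basis. J b \<bullet> J b)"
proof -
  let ?B = "Basis :: 'f set"
  define w where "w = J v"
  define r where "r = v \<bullet> v"
  define n where "n = w \<bullet> w"
  define M where "M = (\<Sum>b\<in>?B. J b \<bullet> J b)"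
  define K where "K a b = - (f * (v \<bullet> a)) *\<^sub>R J b + (f * (v \<bullet> b)) *\<^sub>R J a
      + (2 * f * (J a \<bullet> b) + 2 * k * ((v \<bullet> a) * (w \<bullet> b) - (v \<bullet> b) * (w \<bullet> a))) *\<^sub>R v
      + (f * (w \<bullet> b)) *\<^sub>R a - (f * (w \<bullet> a)) *\<^sub>R b" for a b
  have JJ0: "J a \<bullet> a = 0" "a \<bullet> J a = 0" for a
    using skew[of a a] by (simp_all add: inner_commute)
  have vw: "v \<bullet> w = 0" "w \<bullet> v = 0"
    by (simp_all add: w_def JJ0)
  have vJ: "v \<bullet> J a = - (w \<bullet> a)" "J a \<bullet> v = - (w \<bullet> a)" for a
    using skew[of v a] by (simp_all add: w_def inner_commute)
  have C: "codazzi H a b c = K a b \<bullet> c" for a b c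
  proof -
    have "H a c \<bullet> b - H b c \<bullet> a = 2 * (K a b \<bullet> c)"
      using skew[of c b] skew[of c a] skew[of b a]
      unfolding H_def K_def w_def[symmetric]
      by (simp add: inner_simps) (simp add: inner_commute algebra_simps)
    then show ?thesis by (simp add: codazzi_def)
  qed
  define KK where "KK a b = f\<^sup>2 * ((v \<bullet> a) * (v \<bullet> a) * (J b \<bullet> J b)) + f\<^sup>2 * ((v \<bullet> b) * (v \<bullet> b) * (J a \<bullet> J a))
      + 4 * r * f\<^sup>2 * ((J a \<bullet> b) * (J a \<bullet> b))
      + (8 * r * f * k + 10 * f\<^sup>2) * ((v \<bullet> a) * ((w \<bullet> b) * (J a \<bullet> b)))
      - (8 * r * f * k + 10 * f\<^sup>2) * ((w \<bullet> a) * ((v \<bullet> b) * (J a \<bullet> b)))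
      + (4 * r * k\<^sup>2 + 8 * f * k) * ((v \<bullet> a) * (v \<bullet> a) * ((w \<bullet> b) * (w \<bullet> b)))
      + (4 * r * k\<^sup>2 + 8 * f * k) * ((w \<bullet> a) * (w \<bullet> a) * ((v \<bullet> b) * (v \<bullet> b)))
      - 2 * (4 * r * k\<^sup>2 + 8 * f * k) * ((v \<bullet> a) * (w \<bullet> a) * ((v \<bullet> b) * (w \<bullet> b)))
      + f\<^sup>2 * ((w \<bullet> b) * (w \<bullet> b)) + f\<^sup>2 * ((w \<bullet> a) * (w \<bullet> a))
      - 2 * f\<^sup>2 * ((v \<bullet> a) * ((v \<bullet> b) * (J a \<bullet> J b)))
      - 2 * f\<^sup>2 * ((w \<bullet> a) * ((w \<bullet> b) * (a \<bullet> b)))" for a b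
  have KK: "K a b \<bullet> K a b = KK a b"
    if "a \<in> ?B" "b \<in> ?B" for a b
  proof -
    have "a \<bullet> a = 1" "b \<bullet> b = 1" using that by auto
    moreover have "a \<bullet> J b = - (J a \<bullet> b)" "J b \<bullet> a = - (J a \<bullet> b)" "b \<bullet> J a = J a \<bullet> b"
      using skew[of a b] by (simp_all add: inner_commute)
    moreover have "b \<bullet> a = a \<bullet> b" "J b \<bullet> J a = J a \<bullet> J b" "a \<bullet> v = v \<bullet> a" "b \<bullet> v = v \<bullet> b"
      by (simp_all add: inner_commute)
    ultimately show ?thesis
      unfolding K_def KK_def
      by (simp add: inner_add_left inner_add_right inner_diff_left inner_diff_right JJ0 vw vJ
          flip: r_def) (simp add: algebra_simps power2_eq_square)
  qed
  have wJ: "w \<bullet> J a = - (J w \<bullet> a)" for a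
    using skew[of w a] by simp
  have Jwv: "v \<bullet> J w = - n" by (simp add: vJ n_def)
  have s4: "(\<Sum>a\<in>?B. (v \<bullet> a) * (w \<bullet> J a)) = n"
    by (simp add: wJ sum_negf parseval Jwv)
  have JaJb: "J a \<bullet> J b = - (J (J a) \<bullet> b)" for a b
    using skew[of "J a" b] by simp
  have vJJ: "v \<bullet> J (J a) = - (w \<bullet> J a)" for a
    by (simp add: vJ)
  define SS where "SS g = (\<Sum>a\<in>?B. \<Sum>b\<in>?B. g a b)" for g :: "'f \<Rightarrow> 'f \<Rightarrow> real"
  have SS_linear: "SS (\<lambda>a b. g a b + h a b) = SS g + SS h" "SS (\<lambda>a b. g a b - h a b) = SS g - SS h"
    "SS (\<lambda>a b. c * g a b) = c * SS g" for g h c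
    by (simp_all add: SS_def sum.distrib sum_subtractf sum_distrib_left)
  have sums: "SS (\<lambda>a b. (v \<bullet> a) * (v \<bullet> a) * (J b \<bullet> J b)) = r * M"
    "SS (\<lambda>a b. (v \<bullet> b) * (v \<bullet> b) * (J a \<bullet> J a)) = r * M"
    "SS (\<lambda>a b. (J a \<bullet> b) * (J a \<bullet> b)) = M"
    "SS (\<lambda>a b. (v \<bullet> a) * ((w \<bullet> b) * (J a \<bullet> b))) = n"
    "SS (\<lambda>a b. (w \<bullet> a) * ((v \<bullet> b) * (J a \<bullet> b))) = - n"
    "SS (\<lambda>a b. (v \<bullet> a) * (v \<bullet> a) * ((w \<bullet> b) * (w \<bullet> b))) = r * n"
    "SS (\<lambda>a b. (w \<bullet> a) * (w \<bullet> a) * ((v \<bullet> b) * (v \<bullet> b))) = r * n"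
    "SS (\<lambda>a b. (v \<bullet> a) * (w \<bullet> a) * ((v \<bullet> b) * (w \<bullet> b))) = 0"
    "SS (\<lambda>a b. (w \<bullet> b) * (w \<bullet> b)) = N * n"
    "SS (\<lambda>a b. (w \<bullet> a) * (w \<bullet> a)) = N * n"
    "SS (\<lambda>a b. (w \<bullet> a) * ((w \<bullet> b) * (a \<bullet> b))) = n"
    by (simp_all add: SS_def parseval vJ s4 vw sum_negf M_def[symmetric] r_def[symmetric]
        n_def[symmetric] N_def mult.commute[of M] mult.commute[of n]
        flip: sum_distrib_left sum_distrib_right)
  have s11: "SS (\<lambda>a b. (v \<bullet> a) * ((v \<bullet> b) * (J a \<bullet> J b))) = n"
    by (simp add: SS_def parseval JaJb vJJ sum_negf s4 flip: sum_distrib_left)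
  have norm: "(\<Sum>a\<in>?B. \<Sum>b\<in>?B. \<Sum>c\<in>?B. (codazzi H a b c)\<^sup>2)
      = 8 * k\<^sup>2 * r\<^sup>2 * n + 32 * f * k * r * n + f\<^sup>2 * ((2 * N + 16) * n + 6 * r * M)"
  proof -
    have "(\<Sum>a\<in>?B. \<Sum>b\<in>?B. \<Sum>c\<in>?B. (codazzi H a b c)\<^sup>2) = SS (\<lambda>a b. K a b \<bullet> K a b)"
      by (simp add: C power2_eq_square parseval SS_def)
    also have "\<dots> = 8 * k\<^sup>2 * r\<^sup>2 * n + 32 * f * k * r * n + f\<^sup>2 * ((2 * N + 16) * n + 6 * r * M)"
    proof -
      have "SS (\<lambda>a b. K a b \<bullet> K a b) = SS (\<lambda>a b. KK a b)"
        unfolding SS_def by (intro sum.cong refl) (simp add: KK)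
      also have "\<dots> = 8 * k\<^sup>2 * r\<^sup>2 * n + 32 * f * k * r * n + f\<^sup>2 * ((2 * N + 16) * n + 6 * r * M)"
        unfolding KK_def SS_linear sums s11 by (simp add: algebra_simps power2_eq_square)
      finally show ?thesis .
    qed
    finally show ?thesis .
  qed
  have trace: "(\<Sum>a\<in>?B. codazzi H a b a) = (w \<bullet> b) * (2 * k * r + (N + 2) * f)" for b
  proof -
    have "codazzi H a b a = - f * ((v \<bullet> a) * (J b \<bullet> a)) + 2 * f * ((v \<bullet> a) * (J a \<bullet> b))
        + 2 * k * (w \<bullet> b) * ((v \<bullet> a) * (v \<bullet> a)) - 2 * k * (v \<bullet> b) * ((v \<bullet> a) * (w \<bullet> a))
        + f * (w \<bullet> b) - f * ((w \<bullet> a) * (b \<bullet> a))" if "a \<in> ?B" for a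
      using that unfolding C K_def
      by (simp add: inner_simps JJ0) (simp add: algebra_simps)
    moreover have "(v \<bullet> a) * (J a \<bullet> b) = - ((v \<bullet> a) * (J b \<bullet> a))" for a
      using skew[of a b] by (simp add: inner_commute)
    ultimately show ?thesis
      by (simp add: sum.distrib sum_subtractf sum_negf parseval vJ vw flip: sum_distrib_left r_def)
        (simp add: N_def algebra_simps)
  qed
  have "(\<Sum>b\<in>?B. (\<Sum>a\<in>?B. codazzi H a b a)\<^sup>2) = n * (2 * k * r + (N + 2) * f)\<^sup>2"
    by (simp add: trace power_mult_distrib flip: sum_distrib_right)
      (simp add: power2_eq_square parseval n_def)
  then show ?thesis
    unfolding codazzi_energy_def norm w_def[symmetric] r_def[symmetric] n_def[symmetric] M_def[symmetric]
    by (simp add: algebra_simps power2_eq_square)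
qed

section \<open>Facts from analysis\<close>

text \<open>The mean value theorem is applied twice, first along \<open>X\<close> and then along \<open>Y\<close>.\<close>

lemma mixed_difference_quotient:
  fixes F :: "'a::real_normed_vector \<Rightarrow> real"
  assumes F1: "\<And>p. (F has_derivative F1 p) (at p)"
    and F2: "\<And>p Y. ((\<lambda>q. F1 q Y) has_derivative (\<lambda>X. F2 p X Y)) (at p)"
    and "e > 0"
  shows "\<exists>a b. 0 < a \<and> a < e \<and> 0 < b \<and> b < e \<and>
    F (p + e *\<^sub>R X + e *\<^sub>R Y) - F (p + e *\<^sub>R X) - F (p + e *\<^sub>R Y) + F p
      = e\<^sup>2 * F2 (p + a *\<^sub>R X + b *\<^sub>R Y) Y X"
proof -
  have line: "((\<lambda>t. G (q + t *\<^sub>R Z)) has_real_derivative G1 (q + t *\<^sub>R Z) Z) (at t)"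
    if "\<And>p. (G has_derivative G1 p) (at p)" for G :: "'a \<Rightarrow> real" and G1 q Z t
  proof -
    have "((\<lambda>t. G (q + t *\<^sub>R Z)) has_derivative (\<lambda>t'. G1 (q + t *\<^sub>R Z) (t' *\<^sub>R Z))) (at t)"
      by (rule has_derivative_compose[OF _ that]) (auto intro!: derivative_eq_intros)
    moreover have "linear (G1 p)" for p using that has_derivative_linear by blast
    ultimately show ?thesis
      by (simp add: has_field_derivative_def linear_cmul mult.commute[of _ "G1 _ _"] mult_commute_abs)
  qed
  have shift: "p + a *\<^sub>R X + b *\<^sub>R Y = (p + b *\<^sub>R Y) + a *\<^sub>R X" for a b
    by (simp add: algebra_simps)
  have "\<exists>a>0. a < e \<and> (F ((p + e *\<^sub>R Y) + e *\<^sub>R X) - F (p + e *\<^sub>R X))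
        - (F ((p + e *\<^sub>R Y) + 0 *\<^sub>R X) - F (p + 0 *\<^sub>R X))
      = (e - 0) * (F1 ((p + e *\<^sub>R Y) + a *\<^sub>R X) X - F1 (p + a *\<^sub>R X) X)"
    by (rule MVT2[OF \<open>e > 0\<close>]) (auto intro!: DERIV_diff line F1)
  then obtain a where a: "0 < a" "a < e" and eq1:
    "F (p + e *\<^sub>R X + e *\<^sub>R Y) - F (p + e *\<^sub>R X) - F (p + e *\<^sub>R Y) + F p
      = e * (F1 ((p + a *\<^sub>R X) + e *\<^sub>R Y) X - F1 (p + a *\<^sub>R X) X)"
    by (auto simp: shift[symmetric] algebra_simps)
  have "\<exists>b>0. b < e \<and> F1 ((p + a *\<^sub>R X) + e *\<^sub>R Y) X - F1 ((p + a *\<^sub>R X) + 0 *\<^sub>R Y) X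
      = (e - 0) * F2 ((p + a *\<^sub>R X) + b *\<^sub>R Y) Y X"
    by (rule MVT2[OF \<open>e > 0\<close>]) (intro line F2)
  then obtain b where "0 < b" "b < e"
    "F1 ((p + a *\<^sub>R X) + e *\<^sub>R Y) X - F1 (p + a *\<^sub>R X) X = e * F2 ((p + a *\<^sub>R X) + b *\<^sub>R Y) Y X"
    by auto
  with a eq1 show ?thesis
    by (intro exI[of _ a] exI[of _ b]) (simp add: power2_eq_square)
qed

text \<open>The second difference is symmetric in \<open>X\<close> and \<open>Y\<close>, so both second derivatives are limits of
  the same difference quotients.\<close>

lemma second_derivative_commute:
  fixes F :: "'a::real_normed_vector \<Rightarrow> real"
  assumes F1: "\<And>p. (F has_derivative F1 p) (at p)"
    and F2: "\<And>p Y. ((\<lambda>q. F1 q Y) has_derivative (\<lambda>X. F2 p X Y)) (at p)"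
    and cont: "\<And>X Y. continuous_on UNIV (\<lambda>p. F2 p X Y)"
  shows "F2 p X Y = F2 p Y X"
proof -
  define e :: "nat \<Rightarrow> real" where "e n = 1 / real (Suc n)" for n
  have e0: "e n > 0" for n by (simp add: e_def)
  have e: "e \<longlonglongrightarrow> 0" unfolding e_def by (rule LIMSEQ_Suc[OF lim_1_over_n])
  let ?D = "\<lambda>n. F (p + e n *\<^sub>R X + e n *\<^sub>R Y) - F (p + e n *\<^sub>R X) - F (p + e n *\<^sub>R Y) + F p"
  have lim: "(\<lambda>n. F2 (p + a n *\<^sub>R X + b n *\<^sub>R Y) V W) \<longlonglongrightarrow> F2 p V W"
    if "\<And>n. 0 < a n \<and> a n < e n" "\<And>n. 0 < b n \<and> b n < e n" for a b V W
  proof -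
    have "c \<longlonglongrightarrow> 0" if "\<And>n. 0 < c n \<and> c n < e n" for c
      by (rule tendsto_sandwich[OF _ _ tendsto_const e])
        (use that in \<open>auto intro!: always_eventually less_imp_le\<close>)
    then have "a \<longlonglongrightarrow> 0" "b \<longlonglongrightarrow> 0" using that by auto
    then have "(\<lambda>n. p + a n *\<^sub>R X + b n *\<^sub>R Y) \<longlonglongrightarrow> p + 0 *\<^sub>R X + 0 *\<^sub>R Y"
      by (intro tendsto_intros)
    moreover have "isCont (\<lambda>p. F2 p V W) p"
      using cont by (simp add: continuous_on_eq_continuous_at)
    ultimately show ?thesis
      by (intro isCont_tendsto_compose[where g = "\<lambda>p. F2 p V W"]) auto
  qed
  have "\<exists>a b. 0 < a \<and> a < e n \<and> 0 < b \<and> b < e n \<and> ?D n = (e n)\<^sup>2 * F2 (p + a *\<^sub>R X + b *\<^sub>R Y) Y X" for n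
    by (rule mixed_difference_quotient[OF F1 F2 e0])
  then obtain a b where ab: "\<And>n. 0 < a n \<and> a n < e n" "\<And>n. 0 < b n \<and> b n < e n"
    and D1: "\<And>n. ?D n = (e n)\<^sup>2 * F2 (p + a n *\<^sub>R X + b n *\<^sub>R Y) Y X"
    by metis
  have "\<exists>b a. 0 < b \<and> b < e n \<and> 0 < a \<and> a < e n \<and> ?D n = (e n)\<^sup>2 * F2 (p + a *\<^sub>R X + b *\<^sub>R Y) X Y" for n
    using mixed_difference_quotient[OF F1 F2 e0, of n p Y X] by (simp add: algebra_simps)
  then obtain b' a' where ab': "\<And>n. 0 < a' n \<and> a' n < e n" "\<And>n. 0 < b' n \<and> b' n < e n"
    and D2: "\<And>n. ?D n = (e n)\<^sup>2 * F2 (p + a' n *\<^sub>R X + b' n *\<^sub>R Y) X Y"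
    by metis
  have "F2 (p + a n *\<^sub>R X + b n *\<^sub>R Y) Y X = F2 (p + a' n *\<^sub>R X + b' n *\<^sub>R Y) X Y" for n
    using D1[of n] D2[of n] e0[of n] by simp
  then show ?thesis
    using LIMSEQ_unique[OF lim[OF ab, of Y X]] lim[OF ab', of X Y] by simp
qed

lemma smooth_plane_partials:
  fixes F :: "real \<times> real \<Rightarrow> real"
  assumes "smooth F"
  obtains d1 d2 d11 d12 d22 where
    "\<And>q. (F has_derivative (\<lambda>h. d1 q * fst h + d2 q * snd h)) (at q)"
    "\<And>q. (d1 has_derivative (\<lambda>h. d11 q * fst h + d12 q * snd h)) (at q)"
    "\<And>q. (d2 has_derivative (\<lambda>h. d12 q * fst h + d22 q * snd h)) (at q)"
    "continuous_on UNIV d11" "continuous_on UNIV d12" "continuous_on UNIV d22"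
proof -
  define F1 where "F1 q v = frechet_derivative F (at q) v" for q v
  define F2 where "F2 q w v = frechet_derivative (\<lambda>x. F1 x v) (at q) w" for q w v
  have "Ck (Suc (Suc 0)) F" using assms unfolding smooth_def by blast
  then have C: "\<And>q. F differentiable (at q)" "\<And>v q. (\<lambda>x. F1 x v) differentiable (at q)"
    "\<And>v w. continuous_on UNIV (\<lambda>q. F2 q w v)"
    unfolding F2_def F1_def Ck.simps by blast+
  have F1: "(F has_derivative F1 q) (at q)" for q
    using C(1) unfolding F1_def by (simp add: frechet_derivative_works)
  have F2: "((\<lambda>x. F1 x v) has_derivative (\<lambda>w. F2 q w v)) (at q)" for q v
    using C(2) unfolding F2_def by (simp add: frechet_derivative_works)
  have expand: "L = (\<lambda>h. L (1, 0) * fst h + L (0, 1) * snd h)" if "linear L" for L :: "real \<times> real \<Rightarrow> real"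
  proof
    fix h :: "real \<times> real"
    have "L h = L (fst h *\<^sub>R (1, 0) + snd h *\<^sub>R (0, 1))" by simp
    then show "L h = L (1, 0) * fst h + L (0, 1) * snd h"
      unfolding linear_add[OF that] linear_cmul[OF that] by simp
  qed
  have commute: "F2 q (0, 1) (1, 0) = F2 q (1, 0) (0, 1)" for q
    by (rule second_derivative_commute[OF F1 F2 C(3)])
  show ?thesis
  proof (rule that[of "\<lambda>q. F1 q (1, 0)" "\<lambda>q. F1 q (0, 1)" "\<lambda>q. F2 q (1, 0) (1, 0)"
        "\<lambda>q. F2 q (1, 0) (0, 1)" "\<lambda>q. F2 q (0, 1) (0, 1)"])
    fix q
    show "(F has_derivative (\<lambda>h. F1 q (1, 0) * fst h + F1 q (0, 1) * snd h)) (at q)"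
      using F1 expand[OF has_derivative_linear[OF F1]] by metis
    show "((\<lambda>q. F1 q (1, 0)) has_derivative (\<lambda>h. F2 q (1, 0) (1, 0) * fst h + F2 q (1, 0) (0, 1) * snd h)) (at q)"
      using F2[of "(1, 0)" q] expand[OF has_derivative_linear[OF F2[of "(1, 0)" q]]] commute by metis
    show "((\<lambda>q. F1 q (0, 1)) has_derivative (\<lambda>h. F2 q (1, 0) (0, 1) * fst h + F2 q (0, 1) (0, 1) * snd h)) (at q)"
      using F2[of "(0, 1)" q] expand[OF has_derivative_linear[OF F2[of "(0, 1)" q]]] by metis
  qed (rule C(3))+
qed

lemma integrable_continuous_compact_support:
  fixes h :: "'a::euclidean_space \<Rightarrow> real"
  assumes "continuous_on UNIV h" "compact K" "\<And>p. p \<notin> K \<Longrightarrow> h p = 0"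
  shows "integrable lborel h"
proof -
  have "integrable lborel (\<lambda>p. indicator K p *\<^sub>R h p)"
    using borel_integrable_compact[OF \<open>compact K\<close>, of h] assms(1)
    by (simp add: continuous_on_subset)
  moreover have "(\<lambda>p. indicator K p *\<^sub>R h p) = h"
    using assms(3) by (auto simp: indicator_def fun_eq_iff)
  ultimately show ?thesis by simp
qed

lemma integral_pos_continuous:
  fixes h :: "'a::euclidean_space \<Rightarrow> real"
  assumes cont: "continuous_on UNIV h" and int: "integrable lborel h"
    and nonneg: "\<And>p. h p \<ge> 0" and pos: "h p0 > 0"
  shows "(\<integral>p. h p \<partial>lborel) > 0"
proof -
  have "(\<integral>p. h p \<partial>lborel) \<noteq> 0"
  proof
    assume "(\<integral>p. h p \<partial>lborel) = 0"
    then have "AE p in lborel. h p = 0"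
      using integral_nonneg_eq_0_iff_AE[OF int] nonneg by simp
    then have "{p. h p \<noteq> 0} \<in> null_sets lborel"
      using borel_measurable_continuous_onI[OF cont] by (subst AE_iff_null_sets) auto
    then have "negligible {p. h p \<noteq> 0}"
      by (simp add: negligible_iff_null_sets null_sets_completionI)
    moreover have "open {p. h p \<noteq> 0}"
      using open_Collect_neq[OF cont continuous_on_const] by simp
    ultimately show False
      using open_not_negligible pos by fastforce
  qed
  moreover have "(\<integral>p. h p \<partial>lborel) \<ge> 0" using nonneg by simp
  ultimately show ?thesis by linarith
qed

text \<open>By translation invariance all difference quotients have integral zero, and they converge
  dominatedly to the derivative.\<close>

lemma integral_directional_derivative:
  fixes h :: "'a::euclidean_space \<Rightarrow> real"
  assumes deriv: "\<And>p. ((\<lambda>t. h (p + t *\<^sub>R e)) has_real_derivative h' p) (at 0)"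
    and cont: "continuous_on UNIV h" "continuous_on UNIV h'"
    and K: "compact K" "\<And>p. p \<notin> K \<Longrightarrow> h p = 0" "\<And>p. p \<notin> K \<Longrightarrow> h' p = 0"
  shows "(\<integral>p. h' p \<partial>lborel) = 0"
proof -
  define u where "u n p = (h (p + (1 / real (Suc n)) *\<^sub>R e) - h p) * real (Suc n)" for n p
  have line: "((\<lambda>t. h (p + t *\<^sub>R e)) has_real_derivative h' (p + t *\<^sub>R e)) (at t)" for p t
    using DERIV_shift[of "\<lambda>t. h (p + t *\<^sub>R e)" "h' (p + t *\<^sub>R e)" 0 t] deriv[of "p + t *\<^sub>R e"]
    by (simp add: algebra_simps)
  have "compact (h' ` K)"
    by (rule compact_continuous_image[OF continuous_on_subset[OF cont(2)] K(1)]) simp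
  then obtain M where M: "\<And>p. p \<in> K \<Longrightarrow> \<bar>h' p\<bar> \<le> M"
    using compact_imp_bounded bounded_real by (metis image_eqI)
  define M' where "M' = max M 0"
  have M': "\<bar>h' p\<bar> \<le> M'" for p
    using M[of p] K(3)[of p] by (cases "p \<in> K") (auto simp: M'_def)
  \<comment> \<open>The step sizes are at most 1, so this compact set contains the supports of all difference
    quotients.\<close>
  define K' where "K' = (\<lambda>(p, t). p - t *\<^sub>R e) ` (K \<times> {0..1})"
  have "compact K'"
    unfolding K'_def using K(1)
    by (intro compact_continuous_image compact_Times compact_Icc)
      (auto intro!: continuous_intros simp: case_prod_beta)
  have mem: "p + t *\<^sub>R e \<notin> K" if "p \<notin> K'" "0 \<le> t" "t \<le> 1" for p t
    using that unfolding K'_def by (force simp: image_iff)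
  have bound: "norm (u n p) \<le> indicator K' p *\<^sub>R M'" for n p
  proof -
    have "\<exists>z>0. z < 1 / real (Suc n) \<and> h (p + (1 / real (Suc n)) *\<^sub>R e) - h (p + 0 *\<^sub>R e)
        = (1 / real (Suc n) - 0) * h' (p + z *\<^sub>R e)"
      by (rule MVT2) (auto intro: line)
    then obtain z where z: "0 < z" "z < 1 / real (Suc n)" and "u n p = h' (p + z *\<^sub>R e)"
      by (auto simp: u_def)
    moreover have "z \<le> 1" using z by (smt (verit) divide_le_eq_1 of_nat_0_less_iff of_nat_Suc of_nat_0_le_iff)
    ultimately show ?thesis
      using M' mem[of p z] K(3)[of "p + z *\<^sub>R e"] by (cases "p \<in> K'") auto
  qed
  have h_int: "integrable lborel h"
    by (rule integrable_continuous_compact_support[OF cont(1) K(1,2)])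
  have "(\<integral>p. u n p \<partial>lborel) = 0" for n
  proof -
    let ?e = "(1 / real (Suc n)) *\<^sub>R e"
    have [measurable]: "h \<in> borel_measurable borel"
      by (rule borel_measurable_continuous_onI[OF cont(1)])
    have "integrable (distr lborel borel ((+) ?e)) h"
      unfolding lborel_distr_plus by (rule h_int)
    then have "integrable lborel (\<lambda>p. h (?e + p))"
      by (subst (asm) integrable_distr_eq) auto
    moreover have "(\<integral>p. h (?e + p) \<partial>lborel) = (\<integral>p. h p \<partial>distr lborel borel ((+) ?e))"
      by (subst integral_distr) auto
    ultimately have *: "integrable lborel (\<lambda>p. h (?e + p))"
      "(\<integral>p. h (?e + p) \<partial>lborel) = (\<integral>p. h p \<partial>lborel)"
      unfolding lborel_distr_plus by auto
    then show ?thesis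
      using h_int unfolding u_def
      by (subst integral_mult_left_zero) (simp add: add.commute)
  qed
  moreover have "(\<lambda>n. \<integral>p. u n p \<partial>lborel) \<longlonglongrightarrow> (\<integral>p. h' p \<partial>lborel)"
  proof (rule integral_dominated_convergence[where w = "\<lambda>p. indicator K' p *\<^sub>R M'"])
    show "integrable lborel (\<lambda>p. indicator K' p *\<^sub>R M')"
      using borel_integrable_compact[OF \<open>compact K'\<close>, of "\<lambda>_. M'"] by simp
    show "h' \<in> borel_measurable lborel"
      using borel_measurable_continuous_onI[OF cont(2)] by simp
    have "continuous_on UNIV (u n)" for n
      unfolding u_def by (intro continuous_intros continuous_on_compose2[OF cont(1)]) auto
    then show "u n \<in> borel_measurable lborel" for n
      using borel_measurable_continuous_onI[of "u n"] by simp
    show "AE p in lborel. (\<lambda>n. u n p) \<longlonglongrightarrow> h' p"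
    proof (rule AE_I2)
      fix p
      have "((\<lambda>t. (h (p + t *\<^sub>R e) - h p) / t) \<longlongrightarrow> h' p) (at 0)"
        using deriv[of p] by (simp add: has_field_derivative_iff)
      moreover have "filterlim (\<lambda>n. 1 / real (Suc n)) (at 0) sequentially"
        unfolding filterlim_at using LIMSEQ_Suc[OF lim_1_over_n] by auto
      ultimately have "(\<lambda>n. (h (p + (1 / real (Suc n)) *\<^sub>R e) - h p) / (1 / real (Suc n))) \<longlonglongrightarrow> h' p"
        by (rule filterlim_compose)
      then show "(\<lambda>n. u n p) \<longlonglongrightarrow> h' p" by (simp add: u_def)
    qed
  qed (use bound in auto)
  ultimately have "(\<lambda>n::nat. 0::real) \<longlonglongrightarrow> (\<integral>p. h' p \<partial>lborel)" by simp
  then show ?thesis using LIMSEQ_unique[OF _ tendsto_const] by blast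
qed

text \<open>A function of \<open>t > 0\<close> with vanishing second derivative is affine, and vanishes if its support
  is bounded.\<close>

lemma second_derivative_nonzero:
  fixes F :: "real \<times> real \<Rightarrow> real"
  assumes F: "\<And>q. (F has_derivative (\<lambda>h. d1 q * fst h + d2 q * snd h)) (at q)"
    and d2: "\<And>q. (d2 has_derivative (\<lambda>h. d12 q * fst h + d22 q * snd h)) (at q)"
    and vanish: "\<And>t. t > R \<Longrightarrow> F (t1, t) = 0" and "t2 \<ge> 0" "F (t1, t2) \<noteq> 0"
  obtains t where "t > 0" "d22 (t1, t) \<noteq> 0"
proof (rule ccontr)
  assume "\<not> thesis"
  with that have zero: "d22 (t1, t) = 0" if "t > 0" for t using that by blast
  have dF: "((\<lambda>t. F (t1, t)) has_real_derivative d2 (t1, t)) (at t)" for t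
  proof -
    have "((\<lambda>t. (t1, t)) has_derivative (\<lambda>t. (0, t))) (at t)"
      by (auto intro!: derivative_eq_intros)
    from has_derivative_compose[OF this F] show ?thesis
      by (simp add: has_field_derivative_def mult_commute_abs)
  qed
  have dd2: "((\<lambda>t. d2 (t1, t)) has_real_derivative d22 (t1, t)) (at t)" for t
  proof -
    have "((\<lambda>t. (t1, t)) has_derivative (\<lambda>t. (0, t))) (at t)"
      by (auto intro!: derivative_eq_intros)
    from has_derivative_compose[OF this d2] show ?thesis
      by (simp add: has_field_derivative_def mult_commute_abs)
  qed
  define b where "b = max (R + 1) (t2 + 1)"
  have b: "b > R" "b > t2" "b > 0" using assms(4) by (auto simp: b_def)
  have d2b: "d2 (t1, b) = 0"
  proof -
    have "((\<lambda>t. F (t1, t)) has_real_derivative 0) (at b)"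
      by (rule has_field_derivative_transform_within_open[of "\<lambda>_. 0" _ _ "{R<..}"])
        (use b vanish in auto)
    with dF show ?thesis by (rule DERIV_unique)
  qed
  have d2_0: "d2 (t1, t) = 0" if "0 < t" "t < b" for t
  proof -
    have "\<exists>z>t. z < b \<and> d2 (t1, b) - d2 (t1, t) = (b - t) * d22 (t1, z)"
      by (rule MVT2) (use that dd2 in auto)
    with zero d2b that show ?thesis by auto
  qed
  have "\<exists>z>t2. z < b \<and> F (t1, b) - F (t1, t2) = (b - t2) * d2 (t1, z)"
    by (rule MVT2) (use b dF in auto)
  with d2_0 vanish[OF b(1)] assms(4,5) show False by auto
qed

section \<open>Connections with values in rotations of the fibre\<close>

definition squared_norms :: "'e::euclidean_space \<times> 'f::euclidean_space \<Rightarrow> real \<times> real" where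
  "squared_norms p = (fst p \<bullet> fst p, snd p \<bullet> snd p)"

text \<open>The connection form \<open>A (x, u) b = F (|x|\<^sup>2, |u|\<^sup>2) G b x u\<close>, where \<open>G b x\<close> is a skew endomorphism of the
  fibre, together with the partial derivatives of \<open>F\<close>.  For the metrics of the theorem \<open>F\<close> extends
  \<open>\<phi>\<close>, and \<open>G b x\<close> is the fundamental field of \<open>[x, b]\<close>.\<close>

locale rotational_connection =
  fixes G :: "'e::euclidean_space \<Rightarrow> 'e \<Rightarrow> 'f::euclidean_space \<Rightarrow> 'f"
    and F d1 d2 d11 d12 d22 :: "real \<times> real \<Rightarrow> real"
    and K :: "('e \<times> 'f) set"
  assumes G_bilinear: "bounded_bilinear (G b)"
    and G_linear: "linear (\<lambda>b. G b x v)"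
    and G_skew: "G b x v \<bullet> w = - (v \<bullet> G b x w)"
    and F_deriv: "(F has_derivative (\<lambda>h. d1 q * fst h + d2 q * snd h)) (at q)"
    and d1_deriv: "(d1 has_derivative (\<lambda>h. d11 q * fst h + d12 q * snd h)) (at q)"
    and d2_deriv: "(d2 has_derivative (\<lambda>h. d12 q * fst h + d22 q * snd h)) (at q)"
    and d_cont: "continuous_on UNIV d11" "continuous_on UNIV d12" "continuous_on UNIV d22"
    and K: "compact K" "p \<notin> K \<Longrightarrow> F (squared_norms p) = 0"
begin

definition psi1 :: "'e \<times> 'f \<Rightarrow> 'e \<times> 'f \<Rightarrow> real" where
  "psi1 p X = d1 (squared_norms p) * (2 * (fst p \<bullet> fst X)) + d2 (squared_norms p) * (2 * (snd p \<bullet> snd X))"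

definition psi2 :: "'e \<times> 'f \<Rightarrow> 'e \<times> 'f \<Rightarrow> 'e \<times> 'f \<Rightarrow> real" where
  "psi2 p X Y =
     (d11 (squared_norms p) * (2 * (fst p \<bullet> fst X)) + d12 (squared_norms p) * (2 * (snd p \<bullet> snd X)))
       * (2 * (fst p \<bullet> fst Y))
     + (d12 (squared_norms p) * (2 * (fst p \<bullet> fst X)) + d22 (squared_norms p) * (2 * (snd p \<bullet> snd X)))
       * (2 * (snd p \<bullet> snd Y))
     + d1 (squared_norms p) * (2 * (fst X \<bullet> fst Y)) + d2 (squared_norms p) * (2 * (snd X \<bullet> snd Y))"

lemma squared_norms_deriv:
  "(squared_norms has_derivative (\<lambda>X. (2 * (fst p \<bullet> fst X), 2 * (snd p \<bullet> snd X)))) (at p)"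
  unfolding squared_norms_def
  by (auto intro!: derivative_eq_intros simp: inner_commute)

lemma psi_deriv: "((\<lambda>q. F (squared_norms q)) has_derivative psi1 p) (at p)"
  using has_derivative_compose[OF squared_norms_deriv F_deriv] by (simp add: psi1_def[abs_def])

lemma psi1_deriv: "((\<lambda>q. psi1 q Y) has_derivative (\<lambda>X. psi2 p X Y)) (at p)"
proof -
  have 1: "((\<lambda>q. d1 (squared_norms q)) has_derivative
      (\<lambda>X. d11 (squared_norms p) * (2 * (fst p \<bullet> fst X)) + d12 (squared_norms p) * (2 * (snd p \<bullet> snd X)))) (at p)"
    using has_derivative_compose[OF squared_norms_deriv d1_deriv] by simp
  have 2: "((\<lambda>q. d2 (squared_norms q)) has_derivative
      (\<lambda>X. d12 (squared_norms p) * (2 * (fst p \<bullet> fst X)) + d22 (squared_norms p) * (2 * (snd p \<bullet> snd X)))) (at p)"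
    using has_derivative_compose[OF squared_norms_deriv d2_deriv] by simp
  show ?thesis
    unfolding psi1_def
    by (rule has_derivative_eq_rhs, (rule has_derivative_add has_derivative_mult 1 2
          has_derivative_const has_derivative_inner_left has_derivative_fst has_derivative_snd
          has_derivative_ident)+)
      (auto simp: psi2_def fun_eq_iff algebra_simps)
qed

lemma d_cont1: "continuous_on UNIV d1" "continuous_on UNIV d2"
  by (intro continuous_at_imp_continuous_on ballI has_derivative_continuous[OF d1_deriv]
      has_derivative_continuous[OF d2_deriv])+

lemma continuous_squared_norms: "continuous_on UNIV squared_norms"
  unfolding squared_norms_def by (intro continuous_intros)

lemma continuous_on_squared_norms:
  "continuous_on UNIV h \<Longrightarrow> continuous_on UNIV (\<lambda>p. h (squared_norms p))" for h :: "real \<times> real \<Rightarrow> real"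
  by (rule continuous_on_compose2[OF _ continuous_squared_norms]) auto

lemmas d_squared_norms_cont =
  d_cont1[THEN continuous_on_squared_norms] d_cont[THEN continuous_on_squared_norms]

definition A :: "'e \<times> 'f \<Rightarrow> 'e \<Rightarrow> 'f" where
  "A p b = F (squared_norms p) *\<^sub>R G b (fst p) (snd p)"

definition A1 :: "'e \<times> 'f \<Rightarrow> 'e \<times> 'f \<Rightarrow> 'e \<Rightarrow> 'f" where
  "A1 p X b = F (squared_norms p) *\<^sub>R (G b (fst p) (snd X) + G b (fst X) (snd p))
     + psi1 p X *\<^sub>R G b (fst p) (snd p)"

definition A2 :: "'e \<times> 'f \<Rightarrow> 'e \<times> 'f \<Rightarrow> 'e \<times> 'f \<Rightarrow> 'e \<Rightarrow> 'f" where
  "A2 p X Y b = F (squared_norms p) *\<^sub>R (G b (fst X) (snd Y) + G b (fst Y) (snd X))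
     + psi1 p X *\<^sub>R (G b (fst p) (snd Y) + G b (fst Y) (snd p))
     + (psi1 p Y *\<^sub>R (G b (fst p) (snd X) + G b (fst X) (snd p))
        + psi2 p X Y *\<^sub>R G b (fst p) (snd p))"

sublocale C2_shear A A1 A2
proof
  fix p X Y :: "'e \<times> 'f" and b b' :: 'e and c :: real
  note G_deriv = bounded_bilinear.FDERIV[OF G_bilinear]
  show "A p (b + b') = A p b + A p b'"
    by (simp add: A_def linear_add[OF G_linear] algebra_simps)
  show "A p (c *\<^sub>R b) = c *\<^sub>R A p b"
    by (simp add: A_def linear_cmul[OF G_linear])
  show "((\<lambda>q. A q b) has_derivative (\<lambda>X. A1 p X b)) (at p)"
    unfolding A_def A1_def
    by (intro has_derivative_scaleR psi_deriv G_deriv has_derivative_fst has_derivative_snd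
        has_derivative_ident)
  show "((\<lambda>q. A1 q Y b) has_derivative (\<lambda>X. A2 p X Y b)) (at p)"
    unfolding A1_def
    by (rule has_derivative_eq_rhs, (rule has_derivative_add has_derivative_scaleR psi_deriv psi1_deriv
        has_derivative_const G_deriv has_derivative_fst has_derivative_snd has_derivative_ident)+)
      (simp add: A2_def fun_eq_iff bounded_bilinear.zero_left[OF G_bilinear]
        bounded_bilinear.zero_right[OF G_bilinear])
  show "A2 p X Y b = A2 p Y X b"
    by (simp add: A2_def psi2_def algebra_simps inner_commute)
  have "continuous_on UNIV (\<lambda>p :: 'e \<times> 'f. F (squared_norms p))"
    by (rule continuous_at_imp_continuous_on, rule ballI, rule has_derivative_continuous,
        rule psi_deriv)
  then show "continuous_on UNIV (\<lambda>p. A2 p X Y b)"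
    unfolding A2_def psi1_def psi2_def
    by (intro continuous_intros d_squared_norms_cont bounded_bilinear.continuous_on[OF G_bilinear])
qed

lemma A_vanishes: "p \<notin> K \<Longrightarrow> A p b = 0"
  using K(2) by (simp add: A_def)

lemma linear_G: "linear (G b x)"
  using bounded_bilinear.bounded_linear_right[OF G_bilinear] linear_conv_bounded_linear by blast

definition energy :: "'e \<Rightarrow> 'e \<times> 'f \<Rightarrow> real" where
  "energy b p = 12 * (d22 (squared_norms p))\<^sup>2 * (snd p \<bullet> snd p)\<^sup>2
     * (G b (fst p) (snd p) \<bullet> G b (fst p) (snd p))"

text \<open>A vector field along the fibres, in direction \<open>c\<close>.  Its two coefficients are chosen such that
  subtracting its divergence from the Codazzi energy of \<open>A\<close> removes all terms that involve the
  first derivative of \<open>F\<close> with respect to \<open>|u|\<^sup>2\<close>, leaving the nonnegative function \<open>energy\<close>.\<close>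

definition flux :: "'e \<Rightarrow> 'f \<Rightarrow> 'e \<times> 'f \<Rightarrow> real" where
  "flux b c p = (let v = snd p; w = G b (fst p) v in
     (d2 (squared_norms p))\<^sup>2 * ((2 - real DIM('f)) * (w \<bullet> w) * (v \<bullet> c)
       - 12 * (v \<bullet> v) * (G b (fst p) w \<bullet> c)))"

definition flux' :: "'e \<Rightarrow> 'f \<Rightarrow> 'e \<times> 'f \<Rightarrow> real" where
  "flux' b c p = (let v = snd p; J = G b (fst p); w = J v in
     4 * d2 (squared_norms p) * d22 (squared_norms p) * (v \<bullet> c)
       * ((2 - real DIM('f)) * (w \<bullet> w) * (v \<bullet> c) - 12 * (v \<bullet> v) * (J w \<bullet> c))
     + (d2 (squared_norms p))\<^sup>2 * ((2 - real DIM('f)) * (2 * (w \<bullet> J c) * (v \<bullet> c) + (w \<bullet> w) * (c \<bullet> c))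
       - 12 * (2 * (v \<bullet> c) * (J w \<bullet> c) + (v \<bullet> v) * (J (J c) \<bullet> c))))"

lemma flux_deriv: "((\<lambda>t. flux b c (p + t *\<^sub>R (0, c))) has_real_derivative flux' b c p) (at 0)"
proof -
  define v where "v = snd p"
  define J where "J = G b (fst p)"
  have J: "J (v + t *\<^sub>R c) = J v + t *\<^sub>R J c" "J (J v + t *\<^sub>R J c) = J (J v) + t *\<^sub>R J (J c)" for t
    by (simp_all add: J_def linear_add[OF linear_G] linear_cmul[OF linear_G])
  have sn: "((\<lambda>t. d2 (fst p \<bullet> fst p, (v + t *\<^sub>R c) \<bullet> (v + t *\<^sub>R c))) has_real_derivative
      d22 (squared_norms p) * (2 * (v \<bullet> c))) (at 0)"
  proof -
    have "((\<lambda>t. (fst p \<bullet> fst p, (v + t *\<^sub>R c) \<bullet> (v + t *\<^sub>R c))) has_derivative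
        (\<lambda>t. (0, t * (2 * (v \<bullet> c))))) (at 0)"
      by (auto intro!: derivative_eq_intros simp: inner_simps inner_commute fun_eq_iff algebra_simps)
    from has_derivative_compose[OF this d2_deriv] show ?thesis
      by (simp add: has_field_derivative_def squared_norms_def v_def mult_ac mult_commute_abs)
  qed
  have "flux b c (p + t *\<^sub>R (0, c)) = (d2 (fst p \<bullet> fst p, (v + t *\<^sub>R c) \<bullet> (v + t *\<^sub>R c)))\<^sup>2
      * ((2 - real DIM('f)) * ((J v + t *\<^sub>R J c) \<bullet> (J v + t *\<^sub>R J c)) * ((v + t *\<^sub>R c) \<bullet> c)
       - 12 * ((v + t *\<^sub>R c) \<bullet> (v + t *\<^sub>R c)) * ((J (J v) + t *\<^sub>R J (J c)) \<bullet> c))" for t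
    by (simp add: flux_def Let_def squared_norms_def v_def[symmetric] J_def[symmetric] J)
  moreover have "((\<lambda>t. (d2 (fst p \<bullet> fst p, (v + t *\<^sub>R c) \<bullet> (v + t *\<^sub>R c)))\<^sup>2
      * ((2 - real DIM('f)) * ((J v + t *\<^sub>R J c) \<bullet> (J v + t *\<^sub>R J c)) * ((v + t *\<^sub>R c) \<bullet> c)
       - 12 * ((v + t *\<^sub>R c) \<bullet> (v + t *\<^sub>R c)) * ((J (J v) + t *\<^sub>R J (J c)) \<bullet> c)))
      has_real_derivative flux' b c p) (at 0)"
  proof -
    have q: "((\<lambda>t. (x + t *\<^sub>R y) \<bullet> (x + t *\<^sub>R y)) has_real_derivative 2 * (x \<bullet> y)) (at 0)"
      and l: "((\<lambda>t. (x + t *\<^sub>R y) \<bullet> z) has_real_derivative y \<bullet> z) (at 0)" for x y z :: 'f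
      unfolding inner_add_left inner_add_right inner_scaleR_left inner_scaleR_right
      by (auto intro!: derivative_eq_intros simp: inner_commute)
    show ?thesis
      by (rule DERIV_cong, (rule DERIV_diff DERIV_power sn q l DERIV_const DERIV_mult)+)
        (simp add: flux'_def Let_def squared_norms_def v_def[symmetric] J_def[symmetric]
          algebra_simps power2_eq_square)
  qed
  ultimately show ?thesis by simp
qed

lemma vertical_codazzi_energy:
  "codazzi_energy (\<lambda>a c. A2 p (0, a) (0, c) b) = energy b p + (\<Sum>c\<in>Basis. flux' b c p)"
proof -
  define v where "v = snd p"
  define J where "J = G b (fst p)"
  define f where "f = d2 (squared_norms p)"
  define k where "k = d22 (squared_norms p)"
  define n where "n = J v \<bullet> J v"
  define M where "M = (\<Sum>c\<in>Basis. J c \<bullet> J c)"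
  have lin: "linear J" and skew: "J x \<bullet> y = - (x \<bullet> J y)" for x y
    unfolding J_def by (rule linear_G, rule G_skew)
  have "A2 p (0, a) (0, c) b = (2 * f * (v \<bullet> a)) *\<^sub>R J c + (2 * f * (v \<bullet> c)) *\<^sub>R J a
      + (4 * k * (v \<bullet> a) * (v \<bullet> c) + 2 * f * (a \<bullet> c)) *\<^sub>R J v" for a c
    by (simp add: A2_def psi1_def psi2_def v_def J_def f_def k_def
        bounded_bilinear.zero_left[OF G_bilinear] algebra_simps)
  then have E: "codazzi_energy (\<lambda>a c. A2 p (0, a) (0, c) b) =
      n * (12 * k\<^sup>2 * (v \<bullet> v)\<^sup>2 + (56 - 4 * real DIM('f)) * f * k * (v \<bullet> v) + (28 - (real DIM('f))\<^sup>2) * f\<^sup>2)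
      + 12 * f\<^sup>2 * (v \<bullet> v) * M"
    using codazzi_energy_rotation[OF lin skew, of f v k] by (simp add: n_def M_def)
  have Jw: "J (J v) \<bullet> v = - n" using skew[of "J v" v] by (simp add: n_def)
  have "flux' b c p = (4 * f * k * (2 - real DIM('f)) * n) * ((v \<bullet> c) * (v \<bullet> c))
      - (48 * f * k * (v \<bullet> v)) * ((J (J v) \<bullet> c) * (v \<bullet> c))
      - (2 * f\<^sup>2 * (2 - real DIM('f))) * ((J (J v) \<bullet> c) * (v \<bullet> c)) + f\<^sup>2 * (2 - real DIM('f)) * n
      - (24 * f\<^sup>2) * ((J (J v) \<bullet> c) * (v \<bullet> c)) + 12 * f\<^sup>2 * (v \<bullet> v) * (J c \<bullet> J c)"
    if "c \<in> Basis" for c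
    using that skew[of "J v" c] skew[of "J c" c]
    unfolding flux'_def Let_def v_def[symmetric] J_def[symmetric] f_def[symmetric] k_def[symmetric]
      n_def[symmetric]
    by (simp add: algebra_simps power2_eq_square)
  then have "(\<Sum>c\<in>Basis. flux' b c p) = (4 * f * k * (2 - real DIM('f)) * n) * (v \<bullet> v)
      - (48 * f * k * (v \<bullet> v)) * (- n) - (2 * f\<^sup>2 * (2 - real DIM('f))) * (- n)
      + real DIM('f) * (f\<^sup>2 * (2 - real DIM('f)) * n) - (24 * f\<^sup>2) * (- n)
      + 12 * f\<^sup>2 * (v \<bullet> v) * M"
    by (simp add: sum.distrib sum_subtractf parseval Jw M_def flip: sum_distrib_left)
  moreover have "energy b p = 12 * k\<^sup>2 * (v \<bullet> v)\<^sup>2 * n"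
    by (simp add: energy_def k_def v_def n_def J_def)
  ultimately show ?thesis
    unfolding E by (simp add: algebra_simps power2_eq_square)
qed

text \<open>On the zero section \<open>|u|\<^sup>2\<close> is critical, so nothing can be said about the derivative of \<open>F\<close>
  there; but the flux vanishes on the zero section anyway.\<close>

lemma d2_vanishes:
  assumes "p \<notin> K"
  shows "d2 (squared_norms p) = 0 \<or> snd p = 0"
proof -
  have "psi1 p = (\<lambda>_. 0)"
    using derivative_vanishes_off_closed[OF psi_deriv compact_imp_closed[OF K(1)]] K(2) assms by blast
  then have "psi1 p (0, snd p) = 0" by simp
  then show ?thesis by (simp add: psi1_def)
qed

text \<open>The Codazzi energy differs from \<open>energy\<close> by a divergence of compact support.\<close>

lemma integral_collapsing_density_pos:
  assumes "b \<in> Basis" "d22 (squared_norms p) \<noteq> 0" "G b (fst p) (snd p) \<noteq> 0"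
  shows "(\<integral>p. collapsing_density 0 p \<partial>lborel) > 0"
proof -
  have G0: "G b x 0 = 0" for b x
    by (rule linear_0[OF linear_G])
  note cont = continuous_intros d_squared_norms_cont bounded_bilinear.continuous_on[OF G_bilinear]
  have energy_cont: "continuous_on UNIV (energy b)" for b
    unfolding energy_def by (intro cont)
  have flux'_cont: "continuous_on UNIV (flux' b c)" for b c
    unfolding flux'_def Let_def by (intro cont)
  have flux_cont: "continuous_on UNIV (flux b c)" for b c
    unfolding flux_def Let_def by (intro cont)
  have flux_0: "flux b c p = 0" "flux' b c p = 0" if "p \<notin> K" for b c p
    using d2_vanishes[OF that] by (auto simp: flux_def flux'_def Let_def G0)
  have A2_0: "A2 p X Y b = 0" if "p \<notin> K" for p X Y b
    by (rule derivatives_vanish[OF compact_imp_closed[OF K(1)] A_vanishes that])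
  have energy_0: "energy b p = 0" if "p \<notin> K" for b p
  proof -
    have "codazzi_energy (\<lambda>a c. A2 p (0, a) (0, c) b) = 0"
      by (simp add: A2_0[OF that] codazzi_energy_def codazzi_def)
    then show ?thesis
      by (simp add: vertical_codazzi_energy flux_0[OF that])
  qed
  have energy_int: "integrable lborel (energy b)" for b
    by (rule integrable_continuous_compact_support[OF energy_cont K(1) energy_0])
  have flux'_int: "integrable lborel (flux' b c)" for b c
    by (rule integrable_continuous_compact_support[OF flux'_cont K(1) flux_0(2)])
  have flux'_integral: "(\<integral>p. flux' b c p \<partial>lborel) = 0" for b c
    by (rule integral_directional_derivative[OF flux_deriv flux_cont flux'_cont K(1) flux_0])
  have "(\<integral>p. collapsing_density 0 p \<partial>lborel)
      = (\<integral>p. 4 * ((\<Sum>b\<in>Basis. energy b p) + (\<Sum>b\<in>Basis. \<Sum>c\<in>Basis. flux' b c p)) \<partial>lborel)"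
    by (simp add: collapsing_density_0 vertical_codazzi_energy sum.distrib)
  also have "\<dots> = 4 * (\<integral>p. (\<Sum>b\<in>Basis. energy b p) \<partial>lborel)"
    using energy_int flux'_int
    by (simp add: Bochner_Integration.integral_add Bochner_Integration.integral_sum flux'_integral)
  also have "\<dots> > 0"
  proof -
    have "(\<integral>p. (\<Sum>b\<in>Basis. energy b p) \<partial>lborel) > 0"
    proof (rule integral_pos_continuous)
      show "continuous_on UNIV (\<lambda>p. \<Sum>b\<in>Basis. energy b p)"
        by (intro continuous_on_sum energy_cont)
      show "integrable lborel (\<lambda>p. \<Sum>b\<in>Basis. energy b p)"
        using energy_int by simp
      show "(\<Sum>b\<in>Basis. energy b q) \<ge> 0" for q
        by (intro sum_nonneg) (simp add: energy_def)
      have "snd p \<noteq> 0" using assms(3) G0 by auto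
      then have "energy b p > 0" using assms by (simp add: energy_def)
      then show "(\<Sum>b\<in>Basis. energy b p) > 0"
        using assms(1) by (intro sum_pos2[of _ b]) (auto simp: energy_def)
    qed
    then show ?thesis by simp
  qed
  finally show ?thesis .
qed

end

section \<open>The metrics associated with a bilinear map\<close>

lemma fundamental_field_skew:
  fixes Z :: "real^'k" and u w :: "(real^2)^'k"
  shows "fundamental_field Z u \<bullet> w = - (u \<bullet> fundamental_field Z w)"
proof -
  have rot: "vector [- (a $ 2), a $ 1] \<bullet> b = - (a \<bullet> vector [- (b $ 2), b $ 1])" for a b :: "real^2"
    by (simp add: inner_vec_def sum_2)
  have inner: "x \<bullet> y = (\<Sum>j\<in>UNIV. x $ j \<bullet> y $ j)" for x y :: "(real^2)^'k"
    by (simp add: inner_vec_def)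
  show ?thesis
    by (simp add: inner fundamental_field_eq rot flip: sum_negf)
qed

lemma linear_fundamental_field_point: "linear (fundamental_field Z)"
  by (rule linearI) (simp_all add: fundamental_field_eq vec_eq_iff algebra_simps forall_2)

lemma fundamental_field_nonzero:
  fixes Z :: "real^'k"
  assumes "Z \<noteq> 0" "r > 0"
  obtains u :: "(real^2)^'k" where "u \<bullet> u = r" "fundamental_field Z u \<noteq> 0"
proof -
  obtain j where j: "Z $ j \<noteq> 0" using assms(1) by (auto simp: vec_eq_iff)
  define u :: "(real^2)^'k" where "u = axis j (axis 1 (sqrt r))"
  have "u \<bullet> u = r"
    using assms(2) by (simp add: u_def inner_axis_axis)
  moreover have "fundamental_field Z u $ j $ 2 = Z $ j * sqrt r"
    by (simp add: fundamental_field_eq u_def axis_def)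
  then have "fundamental_field Z u \<noteq> 0"
    using j assms(2) by auto
  ultimately show ?thesis by (rule that)
qed

text \<open>Every vector is the sum of a horizontal lift and a vertical vector, and the defining properties
  of the metric determine it on these.\<close>

lemma associated_metric_eq_shear:
  fixes B :: "real^'m \<Rightarrow> real^'m \<Rightarrow> real^'k"
  assumes "bilinear B"
  shows "associated_metric B \<phi> = shear_metric (\<lambda>p Y. psi \<phi> p *\<^sub>R fundamental_field (B (fst p) Y) (snd p))"
proof (intro ext)
  fix p v w :: "('m, 'k) total"
  define L where "L Y = psi \<phi> p *\<^sub>R fundamental_field (B (fst p) Y) (snd p)" for Y
  define h where "h = associated_metric B \<phi> p"
  have lift: "horizontal_lift B \<phi> p Y = (Y, L Y)" for Y
    by (simp add: horizontal_lift_def L_def)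
  have assoc: "is_associated_inner B \<phi> p h"
    unfolding h_def by (rule is_associated_inner_associated_metric[OF assms])
  then have bil: "bilinear h" and sym: "\<And>v w. h v w = h w v"
    and vert: "\<And>W V. h (0, W) (0, V) = W \<bullet> V"
    and orth_set: "{v. \<forall>W. h v (0, W) = 0} = range (horizontal_lift B \<phi> p)"
    and iso: "\<And>Y Y'. h (Y, L Y) (Y', L Y') = Y \<bullet> Y'"
    unfolding is_associated_inner_def inner_product_def lift by blast+
  have orth: "h (Y, L Y) (0, W) = 0" for Y W
    using orth_set lift by (metis (mono_tags, lifting) mem_Collect_eq rangeI)
  have split: "v = (fst v, L (fst v)) + (0, snd v - L (fst v))" for v :: "('m, 'k) total"
    by (simp add: prod_eq_iff)
  have "h v w = h ((fst v, L (fst v)) + (0, snd v - L (fst v)))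
                  ((fst w, L (fst w)) + (0, snd w - L (fst w)))"
    by (rule arg_cong2[OF split split])
  also have "\<dots> = fst v \<bullet> fst w + (snd v - L (fst v)) \<bullet> (snd w - L (fst w))"
    by (simp only: bilinear_ladd[OF bil] bilinear_radd[OF bil] vert iso orth sym[of "(0, _)" "(_, L _)"]
        add_0_right add_0_left)
  finally show "associated_metric B \<phi> p v w
      = shear_metric (\<lambda>p Y. psi \<phi> p *\<^sub>R fundamental_field (B (fst p) Y) (snd p)) p v w"
    by (simp add: h_def shear_metric_def L_def)
qed

lemma bounded_of_compact_support_on_quadrant:
  assumes "compact_support_on_quadrant \<phi>"
  obtains R where "R > 0" "\<And>t1 t2. 0 \<le> t1 \<Longrightarrow> 0 \<le> t2 \<Longrightarrow> t1 > R \<or> t2 > R \<Longrightarrow> \<phi> t1 t2 = 0"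
proof -
  have "bounded {(t1, t2) \<in> quadrant. \<phi> t1 t2 \<noteq> 0}"
    using assms compact_imp_bounded bounded_subset closure_subset
    unfolding compact_support_on_quadrant_def by blast
  then obtain R where R: "R > 0" "\<And>q. q \<in> {(t1, t2) \<in> quadrant. \<phi> t1 t2 \<noteq> 0} \<Longrightarrow> norm q \<le> R"
    by (auto simp: bounded_pos)
  show ?thesis
  proof (rule that[OF R(1)])
    fix t1 t2 :: real assume t: "0 \<le> t1" "0 \<le> t2" "t1 > R \<or> t2 > R"
    have "\<bar>t1\<bar> \<le> norm (t1, t2)" "\<bar>t2\<bar> \<le> norm (t1, t2)"
      using norm_fst_le[of t1 t2] norm_snd_le[of t2 t1] by simp_all
    with t have "\<not> norm (t1, t2) \<le> R" by linarith
    with R(2)[of "(t1, t2)"] t show "\<phi> t1 t2 = 0"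
      by (auto simp: quadrant_def)
  qed
qed

theorem theorem5p2:
  fixes B :: "real^'m \<Rightarrow> real^'m \<Rightarrow> real^'k"
    and \<phi> :: "real \<Rightarrow> real \<Rightarrow> real"
  assumes "CARD('k) = 2 \<or> CARD('k) = 3"
    and "bilinear B"
    and "\<exists>x y. B x y \<noteq> 0"
    and "\<forall>(t1, t2) \<in> quadrant. \<phi> t1 t2 \<ge> 0"
    and "smooth_on_quadrant \<phi>"
    and "compact_support_on_quadrant \<phi>"
    and "\<exists>(t1, t2) \<in> quadrant. \<phi> t1 t2 \<noteq> 0"
  shows "finite {s. s > 0 \<and> a2 (associated_metric B (\<lambda>t1 t2. \<phi> t1 (s\<^sup>2 * t2))) = 0}"
proof -
  obtain F :: "real \<times> real \<Rightarrow> real" where "smooth F"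
    and F_eq: "\<And>t1 t2. 0 \<le> t1 \<Longrightarrow> 0 \<le> t2 \<Longrightarrow> F (t1, t2) = \<phi> t1 t2"
    using assms(5) by (auto simp: smooth_on_quadrant_def quadrant_def)
  obtain d1 d2 d11 d12 d22 where
    F_deriv: "\<And>q. (F has_derivative (\<lambda>h. d1 q * fst h + d2 q * snd h)) (at q)" and
    d1_deriv: "\<And>q. (d1 has_derivative (\<lambda>h. d11 q * fst h + d12 q * snd h)) (at q)" and
    d2_deriv: "\<And>q. (d2 has_derivative (\<lambda>h. d12 q * fst h + d22 q * snd h)) (at q)" and
    d_cont: "continuous_on UNIV d11" "continuous_on UNIV d12" "continuous_on UNIV d22"
    using smooth_plane_partials[OF \<open>smooth F\<close>] by blast
  obtain R where R: "R > 0" "\<And>t1 t2. 0 \<le> t1 \<Longrightarrow> 0 \<le> t2 \<Longrightarrow> t1 > R \<or> t2 > R \<Longrightarrow> \<phi> t1 t2 = 0"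
    using bounded_of_compact_support_on_quadrant[OF assms(6)] by blast
  define G :: "real^'m \<Rightarrow> real^'m \<Rightarrow> (real^2)^'k \<Rightarrow> (real^2)^'k"
    where "G b x v = fundamental_field (B x b) v" for b x v
  define K :: "('m, 'k) total set" where "K = cball 0 (sqrt R) \<times> cball 0 (sqrt R)"
  have B_lin: "linear (B x)" "linear (\<lambda>x. B x b)" for x b
    using assms(2) by (auto simp: bilinear_def)
  interpret rotational_connection G F d1 d2 d11 d12 d22 K
  proof (rule rotational_connection.intro)
    show "(F has_derivative (\<lambda>h. d1 q * fst h + d2 q * snd h)) (at q)" for q by (rule F_deriv)
    show "bounded_bilinear (G b)" for b
    proof -
      have "bilinear (G b)"
        unfolding bilinear_def G_def
        using linear_compose[OF B_lin(2) linear_fundamental_field] linear_fundamental_field_point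
        by (auto simp: o_def)
      then show ?thesis by (simp add: bilinear_conv_bounded_bilinear)
    qed
    show "G b x v \<bullet> w = - (v \<bullet> G b x w)" for b x v w
      unfolding G_def by (rule fundamental_field_skew)
    show "linear (\<lambda>b. G b x v)" for x v
      using linear_compose[OF B_lin(1)[of x] linear_fundamental_field[of v]] by (simp add: G_def[abs_def] o_def)
    show "compact K" unfolding K_def by (intro compact_Times compact_cball)
    show "F (squared_norms p) = 0" if "p \<notin> K" for p
    proof -
      have "norm (fst p) > sqrt R \<or> norm (snd p) > sqrt R"
        using that by (cases p) (auto simp: K_def not_le)
      then have "fst p \<bullet> fst p > R \<or> snd p \<bullet> snd p > R"
        using R(1) by (simp add: real_sqrt_less_iff norm_eq_sqrt_inner)
      then show ?thesis
        using R(2)[of "fst p \<bullet> fst p" "snd p \<bullet> snd p"] by (simp add: squared_norms_def F_eq)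
    qed
  qed (fact d1_deriv d2_deriv d_cont)+
  have "associated_metric B (\<lambda>t1 t2. \<phi> t1 (s\<^sup>2 * t2))
      = shear_metric (\<lambda>p b. (1 / s) *\<^sub>R A (fibre_scaling s p) b)" if "s > 0" for s
  proof -
    have "psi (\<lambda>t1 t2. \<phi> t1 (s\<^sup>2 * t2)) p = F (squared_norms (fibre_scaling s p))" for p :: "('m, 'k) total"
      using \<open>s > 0\<close>
      unfolding psi_def power2_norm_eq_inner
      by (simp add: squared_norms_def fibre_scaling_def F_eq power2_eq_square mult.assoc)
    then show ?thesis
      using \<open>s > 0\<close> unfolding associated_metric_eq_shear[OF assms(2)]
      by (simp add: A_def[abs_def] G_def fibre_scaling_def linear_cmul[OF linear_fundamental_field_point])
  qed
  then have "{s. s > 0 \<and> a2 (associated_metric B (\<lambda>t1 t2. \<phi> t1 (s\<^sup>2 * t2))) = 0}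
      = {s. s > 0 \<and> a2 (shear_metric (\<lambda>p b. (1 / s) *\<^sub>R A (fibre_scaling s p) b)) = 0}"
    by auto
  moreover have "finite \<dots>"
  proof (rule finite_zeros_a2[where 'n = "'m + 'k \<times> 2", OF _ K(1) A_vanishes])
    show "CARD('m + 'k \<times> 2) = DIM((real^'m) \<times> ((real^2)^'k))"
      by simp
    \<comment> \<open>A point with \<open>x \<noteq> 0\<close> is needed, since the bracket \<open>[x, b]\<close> vanishes at \<open>x = 0\<close>; continuity
      provides one.\<close>
    obtain t1 t2 where t: "0 < t1" "0 \<le> t2" "F (t1, t2) \<noteq> 0"
    proof -
      obtain t1 t2 where t: "0 \<le> t1" "0 \<le> t2" "F (t1, t2) \<noteq> 0"
        using assms(7) F_eq by (auto simp: quadrant_def)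
      have "((\<lambda>t. (t, t2)) \<longlongrightarrow> (t1, t2)) (at_right t1)"
        by (intro tendsto_intros)
      then have "((\<lambda>t. F (t, t2)) \<longlongrightarrow> F (t1, t2)) (at_right t1)"
        by (rule isCont_tendsto_compose[OF has_derivative_continuous[OF F_deriv]])
      then have "\<forall>\<^sub>F t in at_right t1. F (t, t2) \<noteq> 0"
        using t(3) by (rule tendsto_imp_eventually_ne)
      moreover have "\<forall>\<^sub>F t in at_right t1. t > t1"
        by (rule eventually_at_right_less)
      ultimately have "\<forall>\<^sub>F t in at_right t1. F (t, t2) \<noteq> 0 \<and> t > t1"
        by (rule eventually_conj)
      then obtain t where "F (t, t2) \<noteq> 0" "t > t1"
        using eventually_happens'[OF trivial_limit_at_right_real] by blast
      then show ?thesis using that[of t t2] t by simp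
    qed
    have vanish: "F (t1, t) = 0" if "t > R" for t
      using R that t(1) F_eq by auto
    obtain r where r: "r > 0" "d22 (t1, r) \<noteq> 0"
      using second_derivative_nonzero[OF F_deriv d2_deriv vanish t(2,3)] by blast
    obtain x0 y where "B x0 y \<noteq> 0" using assms(3) by auto
    then have "x0 \<noteq> 0" using linear_0[OF B_lin(2)] by auto
    have "\<exists>b\<in>Basis. B x0 b \<noteq> 0"
    proof (rule ccontr)
      assume "\<not> ?thesis"
      then have "B x0 y = 0"
        by (subst euclidean_representation[of y, symmetric])
          (simp add: linear_sum[OF B_lin(1)] linear_cmul[OF B_lin(1)])
      with \<open>B x0 y \<noteq> 0\<close> show False ..
    qed
    then obtain b where b: "b \<in> Basis" "B x0 b \<noteq> 0" by auto
    define x where "x = (sqrt t1 / norm x0) *\<^sub>R x0"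
    have "x \<bullet> x = t1"
      using \<open>x0 \<noteq> 0\<close> t(1) by (simp add: x_def power2_norm_eq_inner[symmetric] power_divide dot_square_norm)
    have "B x b \<noteq> 0"
      using b \<open>x0 \<noteq> 0\<close> t(1) by (simp add: x_def linear_cmul[OF B_lin(2)])
    obtain u where "u \<bullet> u = r" "fundamental_field (B x b) u \<noteq> 0"
      using fundamental_field_nonzero[OF \<open>B x b \<noteq> 0\<close> r(1)] by blast
    then show "(\<integral>p. collapsing_density 0 p \<partial>lborel) \<noteq> 0"
      using integral_collapsing_density_pos[OF b(1), of "(x, u)"] r(2) \<open>x \<bullet> x = t1\<close>
      by (simp add: squared_norms_def G_def)
  qed
  ultimately show ?thesis by simp
qed

end
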